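(* Fix $\beta>0$ and $h\in\mathbb{R}$, and suppose there is a number $q$ with $0<q<1$ and a constant $C_0$ depending only on $\beta,h$ such that for every $N$, $$\mathbb{E}\langle (R_{12}-q)^4\rangle \le \frac{C_0}{N^2}.$$ For $1\le i\le N$ let $r_i := \frac{1}{\sqrt N}\sum_{j\ne i} g_{ij}\langle\sigma_j\rangle - \beta(1-q)\langle\sigma_i\rangle$, and let $z$ be a standard Gaussian random variable. Then there is a constant $C(\beta,h)$ depending only on $\beta,h$ (and the constants in the hypothesis) such that for every $N$, every $1\le i\le N$ and every bounded measurable $u:\mathbb{R}\to\mathbb{R}$, $$\bigl|\mathbb{E}u(r_i) - \mathbb{E}u(z\sqrt q)\bigr| \le \frac{C(\beta,h)\|u\|_\infty}{N^{1/4}}.$$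
   Context: Sherrington–Kirkpatrick model: for a positive integer $N$, let $\Sigma_N=\{-1,1\}^N$ and let $g=(g_{ij})_{1\le i<j\le N}$ be i.i.d. standard Gaussian random variables (the disorder); set $g_{ji}:=g_{ij}$. Given $g$, the Gibbs measure on $\Sigma_N$ is $G_N(\sigma)=Z_N^{-1}\exp\bigl(\frac{\beta}{\sqrt N}\sum_{1\le i<j\le N} g_{ij}\sigma_i\sigma_j + h\sum_{i=1}^N\sigma_i\bigr)$, with $Z_N$ the normalizing constant. Replicas $\sigma^1,\sigma^2,\dots$ are independent samples from $G_N$ given $g$, and $\langle\cdot\rangle$ denotes the quenched average (over replicas, $g$ fixed). $\mathbb{E}$ denotes expectation over the disorder. The overlap is $R_{12}=\frac1N\sum_{i=1}^N\sigma^1_i\sigma^2_i$. *)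

theory Defs
  imports "HOL-Probability.Probability"
begin

definition spins :: "nat \<Rightarrow> (nat \<Rightarrow> real) set" where
  "spins N = {\<sigma>. (\<forall>i<N. \<sigma> i = 1 \<or> \<sigma> i = -1) \<and> (\<forall>i. N \<le> i \<longrightarrow> \<sigma> i = 0)}"

definition pairs :: "nat \<Rightarrow> (nat \<times> nat) set" where
  "pairs N = {(i, j). i < j \<and> j < N}"

definition disorder :: "nat \<Rightarrow> (nat \<times> nat \<Rightarrow> real) measure" where
  "disorder N = PiM (pairs N) (\<lambda>_. std_normal_distribution)"

definition gs :: "(nat \<times> nat \<Rightarrow> real) \<Rightarrow> nat \<Rightarrow> nat \<Rightarrow> real" where
  "gs g i j = (if i < j then g (i, j) else g (j, i))"

definition hamil :: "nat \<Rightarrow> real \<Rightarrow> real \<Rightarrow> (nat \<times> nat \<Rightarrow> real) \<Rightarrow> (nat \<Rightarrow> real) \<Rightarrow> real" where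
  "hamil N \<beta> h g \<sigma> =
     \<beta> / sqrt (real N) * (\<Sum>p\<in>pairs N. g p * \<sigma> (fst p) * \<sigma> (snd p))
     + h * (\<Sum>i<N. \<sigma> i)"

definition partition_fn :: "nat \<Rightarrow> real \<Rightarrow> real \<Rightarrow> (nat \<times> nat \<Rightarrow> real) \<Rightarrow> real" where
  "partition_fn N \<beta> h g = (\<Sum>\<sigma>\<in>spins N. exp (hamil N \<beta> h g \<sigma>))"

definition gibbs :: "nat \<Rightarrow> real \<Rightarrow> real \<Rightarrow> (nat \<times> nat \<Rightarrow> real) \<Rightarrow> (nat \<Rightarrow> real) \<Rightarrow> real" where
  "gibbs N \<beta> h g \<sigma> = exp (hamil N \<beta> h g \<sigma>) / partition_fn N \<beta> h g"

definition gavg1 :: "nat \<Rightarrow> real \<Rightarrow> real \<Rightarrow> (nat \<times> nat \<Rightarrow> real) \<Rightarrow> ((nat \<Rightarrow> real) \<Rightarrow> real) \<Rightarrow> real" where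
  "gavg1 N \<beta> h g f = (\<Sum>\<sigma>\<in>spins N. gibbs N \<beta> h g \<sigma> * f \<sigma>)"

definition gavg2 :: "nat \<Rightarrow> real \<Rightarrow> real \<Rightarrow> (nat \<times> nat \<Rightarrow> real)
    \<Rightarrow> ((nat \<Rightarrow> real) \<Rightarrow> (nat \<Rightarrow> real) \<Rightarrow> real) \<Rightarrow> real" where
  "gavg2 N \<beta> h g f = (\<Sum>\<sigma>1\<in>spins N. \<Sum>\<sigma>2\<in>spins N.
       gibbs N \<beta> h g \<sigma>1 * gibbs N \<beta> h g \<sigma>2 * f \<sigma>1 \<sigma>2)"

definition overlap :: "nat \<Rightarrow> (nat \<Rightarrow> real) \<Rightarrow> (nat \<Rightarrow> real) \<Rightarrow> real" where
  "overlap N \<sigma>1 \<sigma>2 = (\<Sum>i<N. \<sigma>1 i * \<sigma>2 i) / real N"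

definition cav_r :: "nat \<Rightarrow> real \<Rightarrow> real \<Rightarrow> real \<Rightarrow> (nat \<times> nat \<Rightarrow> real) \<Rightarrow> nat \<Rightarrow> real" where
  "cav_r N \<beta> h q g i =
     1 / sqrt (real N) * (\<Sum>j\<in>{..<N} - {i}. gs g i j * gavg1 N \<beta> h g (\<lambda>\<sigma>. \<sigma> j))
     - \<beta> * (1 - q) * gavg1 N \<beta> h g (\<lambda>\<sigma>. \<sigma> i)"

end

theory Submission
  imports Defs "HOL-Real_Asymp.Real_Asymp"
begin

text \<open>
  Stein's method. Let \<open>l\<close> be the local field at site \<open>i\<close>, \<open>m\<close> the Gibbs average of the spin at \<open>i\<close>,
  and \<open>r\<close> the Gibbs average of \<open>l\<close> minus \<open>\<beta> (1 - q) m\<close>. Gaussian integration by parts in the couplings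
  of site \<open>i\<close>, with all overlaps replaced by \<open>q\<close>, turns \<open>E (r f(r))\<close> into
  \<open>E ((q + \<beta> q X) f'(r))\<close>, where \<open>X = Cov(l, \<sigma>\<^sub>i) - \<beta> (1 - q) (1 - m\<^sup>2)\<close> with the covariance taken
  under the Gibbs measure; the overlap hypothesis makes the replacement cost \<open>O(N powr (-1/2))\<close>.
  A second integration by parts, applied to one factor of \<open>X\<^sup>2\<close>, shows \<open>E (X\<^sup>2) = O(N powr (-1/2))\<close>, so
  \<open>E \<bar>X\<bar> = O(N powr (-1/4))\<close>, which is the rate of the theorem. The second moment of \<open>l\<close>, needed
  throughout, is bounded by the same device. The Stein equation is solved for continuous \<open>u\<close>
  only; the resulting bound involves just the supremum of \<open>u\<close> and passes to measurable \<open>u\<close> by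
  simultaneous approximation in \<open>L\<^sup>1\<close> of both laws.
\<close>

subsection \<open>Gaussian integration by parts\<close>

text \<open>The term \<open>\<beta> (1 - q) m\<close> in \<open>r\<close> is the Onsager reaction.
  In the averaged field each magnetization responds to its own coupling with site \<open>i\<close>,
  and integration by parts sums these responses to about \<open>\<beta> (1 - q) m\<close>;
  subtracting them leaves only the response of \<open>f(r)\<close>. The term subtracted inside
  \<open>X\<close> has the same origin: it is the leading response of the covariances, so in
  \<open>E (X\<^sup>2)\<close> the main terms cancel.

  The obstacle is that neither the local field nor the overlap error is small or bounded pointwise
  in the disorder. Every remainder is therefore kept as a product of the root mean square of the
  field and that of the overlap error, and is linearized before taking expectations. The fourth
  moment hypothesis enters through the second moment of the overlap error. Half of the exponent is
  lost only in passing from \<open>E (X\<^sup>2)\<close> to \<open>E \<bar>X\<bar>\<close>.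

  Continuity of \<open>u\<close> makes the Stein solution differentiable at every point, as the
  integration by parts requires; only bounds on \<open>f\<close> and \<open>f'\<close> enter, so no
  smoothness of \<open>u\<close> survives in the constant.\<close>

lemma integrable_std_normal_exp:
  "integrable std_normal_distribution (\<lambda>y. exp (a * \<bar>y\<bar>))"
proof -
  have e: "integrable std_normal_distribution (\<lambda>y. exp (c * y))" for c :: real
  proof -
    have eq: "std_normal_density y * exp (c * y) = exp (c\<^sup>2 / 2) * normal_density c 1 y" for y
      unfolding normal_density_def
      by (simp add: exp_add[symmetric] exp_diff[symmetric] mult_exp_exp)
        (simp add: power2_eq_square field_simps)
    show ?thesis
      by (subst integrable_density) (simp_all add: eq)
  qed
  show ?thesis
  proof (rule Bochner_Integration.integrable_bound[OF Bochner_Integration.integrable_add[OF e[of a] e[of "-a"]]])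
    have "exp (a * \<bar>y\<bar>) \<le> exp (a * y) + exp (- a * y)" for y :: real
      by (cases "0 \<le> y") auto
    then show "AE y in std_normal_distribution. norm (exp (a * \<bar>y\<bar>)) \<le> norm (exp (a * y) + exp (- a * y))"
      by (intro AE_I2) (auto intro: order_trans[OF _ abs_ge_self])
  qed simp
qed

lemma has_derivative_std_normal_density:
  "(std_normal_density has_real_derivative - (y * std_normal_density y)) (at y)"
  unfolding normal_density_def by (auto intro!: derivative_eq_intros simp: field_simps)

text \<open>The product of \<open>\<phi>\<close> and the density is an antiderivative of the
  difference of the two integrands. Exponential growth loses against the Gaussian decay, so the
  boundary values vanish along \<open>- n\<close> and \<open>n\<close>.\<close>

lemma gaussian_by_parts:
  fixes \<phi> \<phi>' :: "real \<Rightarrow> real" and A a A' a' :: real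
  assumes d: "\<And>y::real. (\<phi> has_real_derivative \<phi>' y) (at y)"
    and [measurable]: "\<phi>' \<in> borel_measurable borel"
    and b: "\<And>y::real. \<bar>\<phi> y\<bar> \<le> A * exp (a * \<bar>y\<bar>)" and b': "\<And>y::real. \<bar>\<phi>' y\<bar> \<le> A' * exp (a' * \<bar>y\<bar>)"
  shows "(\<integral>y. y * \<phi> y \<partial>std_normal_distribution) = (\<integral>y. \<phi>' y \<partial>std_normal_distribution)"
proof -
  let ?G = "std_normal_distribution"
  let ?\<rho> = std_normal_density
  have [measurable]: "\<phi> \<in> borel_measurable borel"
    using d by (intro borel_measurable_continuous_onI) (meson DERIV_isCont continuous_at_imp_continuous_on)
  have i1: "integrable ?G \<phi>'"
    by (rule Bochner_Integration.integrable_bound[OF integrable_mult_right[OF integrable_std_normal_exp[of a'], of A']])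
      (use b' in \<open>auto intro: order_trans[OF _ abs_ge_self]\<close>)
  have i2: "integrable ?G (\<lambda>y. y * \<phi> y)"
  proof (rule Bochner_Integration.integrable_bound[OF integrable_mult_right[OF integrable_std_normal_exp[of "a+1"], of A]])
    show "AE y in ?G. norm (y * \<phi> y) \<le> norm (A * exp ((a + 1) * \<bar>y\<bar>))"
    proof (rule AE_I2)
      fix y :: real
      have "\<bar>y\<bar> \<le> exp \<bar>y\<bar>" using exp_ge_add_one_self[of "\<bar>y\<bar>"] by linarith
      then have "\<bar>y\<bar> * \<bar>\<phi> y\<bar> \<le> exp \<bar>y\<bar> * (A * exp (a * \<bar>y\<bar>))"
        by (intro mult_mono b) auto
      also have "\<dots> = A * exp ((a + 1) * \<bar>y\<bar>)" by (simp add: exp_add algebra_simps)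
      also have "\<dots> \<le> \<bar>A * exp ((a + 1) * \<bar>y\<bar>)\<bar>" by (rule abs_ge_self)
      finally show "norm (y * \<phi> y) \<le> norm (A * exp ((a + 1) * \<bar>y\<bar>))"
        by (simp only: real_norm_def abs_mult)
    qed
  qed simp
  define H where "H y = \<phi> y * ?\<rho> y" for y
  define h where "h y = ?\<rho> y *\<^sub>R (\<phi>' y - y * \<phi> y)" for y
  have h_int: "integrable lborel h"
    unfolding h_def
    by (subst integrable_density[symmetric]) (use i1 i2 in auto)
  have h_eq: "(\<integral>y. h y \<partial>lborel) = (\<integral>y. \<phi>' y \<partial>?G) - (\<integral>y. y * \<phi> y \<partial>?G)"
    unfolding h_def
    by (subst integral_density[symmetric]) (use i1 i2 in auto)
  have dH: "(H has_real_derivative h y) (at y)" for y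
    unfolding H_def h_def
    by (rule derivative_eq_intros d has_derivative_std_normal_density refl)+ (simp add: algebra_simps)
  have lim: "(\<lambda>n. H (real n)) \<longlonglongrightarrow> 0" "(\<lambda>n. H (- real n)) \<longlonglongrightarrow> 0"
  proof -
    have l0: "(\<lambda>n. A * exp (a * real n) * ?\<rho> (real n)) \<longlonglongrightarrow> 0"
    proof (rule Lim_null_comparison)
      show "(\<lambda>n. \<bar>A\<bar> / sqrt (2 * pi) * exp (a\<^sup>2) * exp (- (real n)\<^sup>2 / 4)) \<longlonglongrightarrow> 0"
        by (intro tendsto_mult_right_zero) real_asymp
      \<comment> \<open>Half of the quadratic decay is spent on absorbing the exponential: the
        inequality is \<open>0 \<le> (a - x / 2)\<^sup>2\<close> in the exponent.\<close>
      have "exp (a * x) * exp (- x\<^sup>2 / 2) \<le> exp (a\<^sup>2) * exp (- x\<^sup>2 / 4)" for x :: real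
        using sum_squares_ge_zero[of "a - x / 2" 0]
        by (simp add: exp_add[symmetric] power2_eq_square algebra_simps)
      from mult_left_mono[OF this, of "\<bar>A\<bar> / sqrt (2 * pi)"]
      show "\<forall>\<^sub>F n in sequentially. norm (A * exp (a * real n) * ?\<rho> (real n))
          \<le> \<bar>A\<bar> / sqrt (2 * pi) * exp (a\<^sup>2) * exp (- (real n)\<^sup>2 / 4)"
        unfolding std_normal_density_def real_norm_def abs_mult abs_exp_cancel
        by (intro always_eventually allI, elim meta_allE[where x="real _"]) (simp add: mult_ac)
    qed
    have "\<bar>H (real n)\<bar> \<le> A * exp (a * real n) * ?\<rho> (real n)" for n
      using b[of "real n"] by (auto simp: H_def abs_mult intro!: mult_right_mono)
    then show "(\<lambda>n. H (real n)) \<longlonglongrightarrow> 0"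
      by (intro Lim_null_comparison[OF _ l0]) auto
    have "\<bar>H (- real n)\<bar> \<le> A * exp (a * real n) * ?\<rho> (real n)" for n
      using b[of "- real n"] by (auto simp: H_def abs_mult std_normal_density_def intro!: mult_right_mono divide_right_mono)
    then show "(\<lambda>n. H (- real n)) \<longlonglongrightarrow> 0"
      by (intro Lim_null_comparison[OF _ l0]) auto
  qed
  have int_n: "(\<integral>y. indicator {- real n..real n} y *\<^sub>R h y \<partial>lborel) = H (real n) - H (- real n)" for n
  proof -
    \<comment> \<open>The gauge integral accepts any derivative that exists everywhere, so
      measurability of \<open>\<phi>'\<close> suffices here; integrability of \<open>h\<close> then
      identifies the result with the Lebesgue integral.\<close>
    have "(h has_integral H (real n) - H (- real n)) {- real n..real n}"
      by (rule fundamental_theorem_of_calculus)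
        (use dH in \<open>auto simp: has_real_derivative_iff_has_vector_derivative intro: has_vector_derivative_at_within\<close>)
    moreover have "set_integrable lborel {- real n..real n} h"
      unfolding set_integrable_def by (rule integrable_mult_indicator[OF _ h_int]) auto
    ultimately show ?thesis
      using set_borel_integral_eq_integral(2)[of "{- real n..real n}" h]
      by (auto simp: set_lebesgue_integral_def integral_unique)
  qed
  have "(\<lambda>n. \<integral>y. indicator {- real n..real n} y *\<^sub>R h y \<partial>lborel) \<longlonglongrightarrow> (\<integral>y. h y \<partial>lborel)"
  proof (rule integral_dominated_convergence[where w="\<lambda>y. \<bar>h y\<bar>"])
    show "AE y in lborel. (\<lambda>n. indicator {- real n..real n} y *\<^sub>R h y) \<longlonglongrightarrow> h y"
    proof (rule AE_I2)
      fix y :: real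
      obtain n0 :: nat where n0: "\<bar>y\<bar> \<le> real n0" using real_arch_simple by blast
      have "\<forall>\<^sub>F n in sequentially. indicator {- real n..real n} y *\<^sub>R h y = h y"
        using eventually_ge_at_top[of n0] by eventually_elim (use n0 in \<open>auto simp: indicator_def\<close>)
      then show "(\<lambda>n. indicator {- real n..real n} y *\<^sub>R h y) \<longlonglongrightarrow> h y"
        by (rule tendsto_eventually)
    qed
  qed (use h_int in \<open>auto simp: indicator_def\<close>)
  moreover have "(\<lambda>n. \<integral>y. indicator {- real n..real n} y *\<^sub>R h y \<partial>lborel) \<longlonglongrightarrow> 0 - 0"
    unfolding int_n by (intro tendsto_diff lim)
  ultimately have "(\<integral>y. h y \<partial>lborel) = 0" using LIMSEQ_unique by fastforce
  with h_eq show ?thesis by simp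
qed

section \<open>Gaussian vectors and functions of exponential growth\<close>

abbreviation gaussian_vector :: "'i set \<Rightarrow> ('i \<Rightarrow> real) measure" where
  "gaussian_vector I \<equiv> PiM I (\<lambda>_. std_normal_distribution)"

text \<open>Exponential growth gives a class that is closed under products and whose members are integrable,
  since the exponential of a sum of coordinates factorizes.\<close>

definition tame :: "'i set \<Rightarrow> (('i \<Rightarrow> real) \<Rightarrow> real) \<Rightarrow> bool" where
  "tame I F \<longleftrightarrow> F \<in> borel_measurable (gaussian_vector I) \<and>
     (\<exists>A a. 0 \<le> A \<and> 0 \<le> a \<and> (\<forall>x. \<bar>F x\<bar> \<le> A * exp (a * (\<Sum>j\<in>I. \<bar>x j\<bar>))))"

lemma tameI:
  assumes "F \<in> borel_measurable (gaussian_vector I)" "0 \<le> A" "0 \<le> a"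
    "\<And>x. \<bar>F x\<bar> \<le> A * exp (a * (\<Sum>j\<in>I. \<bar>x j\<bar>))"
  shows "tame I F"
  using assms by (auto simp: tame_def)

lemma tame_measurable: "tame I F \<Longrightarrow> F \<in> borel_measurable (gaussian_vector I)"
  by (simp add: tame_def)

lemma tame_bounded:
  assumes "F \<in> borel_measurable (gaussian_vector I)" "\<And>x. \<bar>F x\<bar> \<le> B"
  shows "tame I F"
proof (rule tameI[where A=B and a=0])
  show "0 \<le> B" using assms(2)[of undefined] by linarith
qed (use assms in auto)

lemma tame_const [intro, simp]: "tame I (\<lambda>_. c)"
  by (rule tame_bounded) auto

lemma tame_coord:
  assumes "finite I" "p \<in> I"
  shows "tame I (\<lambda>x. x p)"
proof (rule tameI[where A=1 and a=1])
  fix x :: "'a \<Rightarrow> real"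
  have "\<bar>x p\<bar> \<le> (\<Sum>j\<in>I. \<bar>x j\<bar>)" using assms by (intro member_le_sum) auto
  also have "\<dots> \<le> exp (\<Sum>j\<in>I. \<bar>x j\<bar>)" using exp_ge_add_one_self[of "\<Sum>j\<in>I. \<bar>x j\<bar>"] by linarith
  finally show "\<bar>x p\<bar> \<le> 1 * exp (1 * (\<Sum>j\<in>I. \<bar>x j\<bar>))" by simp
next
  show "(\<lambda>x. x p) \<in> borel_measurable (gaussian_vector I)"
    using measurable_component_singleton[OF assms(2), of "\<lambda>_. std_normal_distribution"]
    by simp
qed auto

lemma tame_add:
  assumes "tame I F" "tame I G"
  shows "tame I (\<lambda>x. F x + G x)"
proof -
  obtain A a where F: "F \<in> borel_measurable (gaussian_vector I)" "0 \<le> A" "0 \<le> a"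
    "\<And>x. \<bar>F x\<bar> \<le> A * exp (a * (\<Sum>j\<in>I. \<bar>x j\<bar>))" using assms(1) unfolding tame_def by metis
  obtain B b where G: "G \<in> borel_measurable (gaussian_vector I)" "0 \<le> B" "0 \<le> b"
    "\<And>x. \<bar>G x\<bar> \<le> B * exp (b * (\<Sum>j\<in>I. \<bar>x j\<bar>))" using assms(2) unfolding tame_def by metis
  show ?thesis
  proof (rule tameI[where A="A+B" and a="a+b"])
    fix x :: "'a \<Rightarrow> real"
    let ?S = "\<Sum>j\<in>I. \<bar>x j\<bar>"
    have S: "0 \<le> ?S" by (intro sum_nonneg) auto
    have "A * exp (a * ?S) \<le> A * exp ((a+b) * ?S)" "B * exp (b * ?S) \<le> B * exp ((a+b) * ?S)"
      using F(2,3) G(2,3) S by (auto intro!: mult_left_mono mult_right_mono)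
    with F(4)[of x] G(4)[of x] show "\<bar>F x + G x\<bar> \<le> (A + B) * exp ((a + b) * ?S)"
      by (simp add: distrib_right)
  qed (use F G in auto)
qed

lemma tame_mult:
  assumes "tame I F" "tame I G"
  shows "tame I (\<lambda>x. F x * G x)"
proof -
  obtain A a where F: "F \<in> borel_measurable (gaussian_vector I)" "0 \<le> A" "0 \<le> a"
    "\<And>x. \<bar>F x\<bar> \<le> A * exp (a * (\<Sum>j\<in>I. \<bar>x j\<bar>))" using assms(1) unfolding tame_def by metis
  obtain B b where G: "G \<in> borel_measurable (gaussian_vector I)" "0 \<le> B" "0 \<le> b"
    "\<And>x. \<bar>G x\<bar> \<le> B * exp (b * (\<Sum>j\<in>I. \<bar>x j\<bar>))" using assms(2) unfolding tame_def by metis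
  show ?thesis
  proof (rule tameI[where A="A*B" and a="a+b"])
    fix x :: "'a \<Rightarrow> real"
    let ?S = "\<Sum>j\<in>I. \<bar>x j\<bar>"
    have "\<bar>F x\<bar> * \<bar>G x\<bar> \<le> (A * exp (a * ?S)) * (B * exp (b * ?S))"
      using F(2) by (intro mult_mono F(4) G(4)) auto
    then show "\<bar>F x * G x\<bar> \<le> (A * B) * exp ((a + b) * ?S)"
      by (simp add: abs_mult distrib_right exp_add mult_ac)
  qed (use F G in auto)
qed

lemma tame_diff: "tame I F \<Longrightarrow> tame I G \<Longrightarrow> tame I (\<lambda>x. F x - G x)"
  using tame_add[OF _ tame_mult[OF tame_const[of I "-1"]], of F G] by simp

lemma tame_sum: "(\<And>t. t \<in> T \<Longrightarrow> tame I (F t)) \<Longrightarrow> tame I (\<lambda>x. \<Sum>t\<in>T. F t x)"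
  by (induction T rule: infinite_finite_induct) (auto intro: tame_add)

lemma tame_abs: "tame I F \<Longrightarrow> tame I (\<lambda>x. \<bar>F x\<bar>)"
  by (auto simp: tame_def)

lemma tame_power: "tame I F \<Longrightarrow> tame I (\<lambda>x. F x ^ n)"
  by (induction n) (auto intro: tame_mult)

lemmas tame_intros = tame_const tame_add tame_mult tame_diff tame_sum tame_abs tame_power

lemma prob_space_std_normal: "prob_space std_normal_distribution"
  by (rule prob_space_normal_density) simp

lemma product_prob_space_gaussian: "product_prob_space (\<lambda>_::'i. std_normal_distribution)"
  by (intro product_prob_spaceI prob_space_std_normal)

lemma prob_space_gaussian_vector: "prob_space (gaussian_vector I)"
  by (rule prob_space_PiM) (rule prob_space_std_normal)

lemma tame_integrable:
  assumes "finite I" "tame I F"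
  shows "integrable (gaussian_vector I) F"
proof -
  interpret product_prob_space "\<lambda>_::'a. std_normal_distribution" by (rule product_prob_space_gaussian)
  obtain A a where F: "F \<in> borel_measurable (gaussian_vector I)" "0 \<le> A" "0 \<le> a"
    "\<And>x. \<bar>F x\<bar> \<le> A * exp (a * (\<Sum>j\<in>I. \<bar>x j\<bar>))" using assms(2) unfolding tame_def by metis
  have "integrable (gaussian_vector I) (\<lambda>x. \<Prod>j\<in>I. exp (a * \<bar>x j\<bar>))"
    by (rule product_integrable_prod[OF assms(1) integrable_std_normal_exp])
  then have "integrable (gaussian_vector I) (\<lambda>x. A * exp (a * (\<Sum>j\<in>I. \<bar>x j\<bar>)))"
    by (simp add: sum_distrib_left exp_sum assms(1))
  then show ?thesis
    by (rule Bochner_Integration.integrable_bound) (use F in \<open>auto intro: order_trans[OF _ abs_ge_self]\<close>)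
qed

text \<open>Growth and differentiability are bundled so that one rule per operation delivers both
  the derivative and the integrability that integration by parts asks for. Since \<open>x\<close> is
  arbitrary, inserting \<open>x(p := y)\<close> gives the derivative along the whole line through
  \<open>x\<close>.\<close>

definition partial_at :: "'i set \<Rightarrow> 'i \<Rightarrow> (('i \<Rightarrow> real) \<Rightarrow> real) \<Rightarrow> (('i \<Rightarrow> real) \<Rightarrow> real) \<Rightarrow> bool" where
  "partial_at I p F F' \<longleftrightarrow> tame I F \<and> tame I F' \<and>
     (\<forall>x. ((\<lambda>y. F (x(p := y))) has_real_derivative F' x) (at (x p)))"

text \<open>Fubini isolates coordinate \<open>p\<close>. For fixed values of the others, the tame
  bound splits into a constant times an exponential in the free coordinate, which is the hypothesis
  of the one-dimensional rule.\<close>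

theorem gaussian_vector_by_parts:
  assumes fin: "finite I" and p: "p \<in> I" and F: "partial_at I p F F'"
  shows "(\<integral>x. x p * F x \<partial>gaussian_vector I) = (\<integral>x. F' x \<partial>gaussian_vector I)"
proof -
  interpret product_prob_space "\<lambda>_::'a. std_normal_distribution" by (rule product_prob_space_gaussian)
  define J where "J = I - {p}"
  have J: "I = insert p J" "finite J" "p \<notin> J" using fin p by (auto simp: J_def)
  have tame: "tame I F" "tame I F'" using F by (auto simp: partial_at_def)
  have d: "((\<lambda>y. F (x(p := y))) has_real_derivative F' (x(p := y))) (at y)" for x y
    using F[unfolded partial_at_def, THEN conjunct2, THEN conjunct2, rule_format, of "x(p:=y)"] by simp
  have split: "(\<Sum>j\<in>I. \<bar>(x(p := y)) j\<bar>) = \<bar>y\<bar> + (\<Sum>j\<in>J. \<bar>x j\<bar>)" for x y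
  proof -
    have "(\<Sum>j\<in>J. \<bar>(x(p := y)) j\<bar>) = (\<Sum>j\<in>J. \<bar>x j\<bar>)" using J(3) by (intro sum.cong refl) (metis fun_upd_other)
    moreover have "(\<Sum>j\<in>insert p J. \<bar>(x(p := y)) j\<bar>) = \<bar>y\<bar> + (\<Sum>j\<in>J. \<bar>(x(p := y)) j\<bar>)"
      by (subst sum.insert[OF J(2,3)]) simp
    ultimately show ?thesis by (simp only: J(1)[symmetric])
  qed
  have "(\<integral>x. x p * F x \<partial>gaussian_vector I)
      = (\<integral>x. (\<integral>y. y * F (x(p := y)) \<partial>std_normal_distribution) \<partial>gaussian_vector J)"
    using product_integral_insert[OF J(2,3), of "\<lambda>x. x p * F x"]
      tame_integrable[OF fin tame_mult[OF tame_coord[OF fin p] tame(1)]]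
    unfolding J(1)[symmetric] by simp
  also have "\<dots> = (\<integral>x. (\<integral>y. F' (x(p := y)) \<partial>std_normal_distribution) \<partial>gaussian_vector J)"
  proof (rule Bochner_Integration.integral_cong[OF refl])
    fix x assume x: "x \<in> space (gaussian_vector J)"
    obtain A a where A: "\<And>x. \<bar>F x\<bar> \<le> A * exp (a * (\<Sum>j\<in>I. \<bar>x j\<bar>))" using tame(1) unfolding tame_def by metis
    obtain B b where B: "\<And>x. \<bar>F' x\<bar> \<le> B * exp (b * (\<Sum>j\<in>I. \<bar>x j\<bar>))" using tame(2) unfolding tame_def by metis
    have "(\<lambda>y. F' (x(p := y))) \<in> borel_measurable std_normal_distribution"
    proof (rule measurable_compose[OF _ tame_measurable[OF tame(2)]])
      show "(\<lambda>y. x(p := y)) \<in> measurable std_normal_distribution (gaussian_vector I)"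
        unfolding J(1) using x by (intro measurable_fun_upd[where J=J]) (auto simp: J)
    qed
    then have m: "(\<lambda>y. F' (x(p := y))) \<in> borel_measurable borel" by simp
    show "(\<integral>y. y * F (x(p := y)) \<partial>std_normal_distribution) = (\<integral>y. F' (x(p := y)) \<partial>std_normal_distribution)"
    proof (rule gaussian_by_parts[OF d m])
      show "\<bar>F (x(p := y))\<bar> \<le> A * exp (a * (\<Sum>j\<in>J. \<bar>x j\<bar>)) * exp (a * \<bar>y\<bar>)" for y
        using A[of "x(p := y)"] unfolding split by (simp add: distrib_left exp_add mult_ac)
      show "\<bar>F' (x(p := y))\<bar> \<le> B * exp (b * (\<Sum>j\<in>J. \<bar>x j\<bar>)) * exp (b * \<bar>y\<bar>)" for y
        using B[of "x(p := y)"] unfolding split by (simp add: distrib_left exp_add mult_ac)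
    qed
  qed
  also have "\<dots> = (\<integral>x. F' x \<partial>gaussian_vector I)"
    using product_integral_insert[OF J(2,3), of F'] tame_integrable[OF fin tame(2)]
    unfolding J(1)[symmetric] by simp
  finally show ?thesis .
qed

lemma partial_at_tame: "partial_at I p F F' \<Longrightarrow> tame I F'"
  by (simp add: partial_at_def)

lemma partial_at_cong: "partial_at I p F F' \<Longrightarrow> (\<And>x. F' x = G' x) \<Longrightarrow> partial_at I p F G'"
  by (metis ext)

lemma partial_at_const: "partial_at I p (\<lambda>_. c) (\<lambda>_. 0)"
  by (simp add: partial_at_def)

lemma partial_at_coord:
  assumes "finite I" "j \<in> I"
  shows "partial_at I p (\<lambda>x. x j) (\<lambda>_. if j = p then 1 else 0)"
  using assms by (auto simp: partial_at_def intro: tame_coord)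

lemma partial_at_add:
  "partial_at I p F F' \<Longrightarrow> partial_at I p G G' \<Longrightarrow> partial_at I p (\<lambda>x. F x + G x) (\<lambda>x. F' x + G' x)"
  by (auto simp: partial_at_def intro: tame_add DERIV_add)

lemma partial_at_diff:
  "partial_at I p F F' \<Longrightarrow> partial_at I p G G' \<Longrightarrow> partial_at I p (\<lambda>x. F x - G x) (\<lambda>x. F' x - G' x)"
  by (auto simp: partial_at_def intro: tame_diff DERIV_diff)

lemma partial_at_mult:
  assumes "partial_at I p F F'" "partial_at I p G G'"
  shows "partial_at I p (\<lambda>x. F x * G x) (\<lambda>x. F' x * G x + F x * G' x)"
proof -
  have "((\<lambda>y. F (x(p := y)) * G (x(p := y))) has_real_derivative F' x * G x + F x * G' x) (at (x p))" for x
    using assms DERIV_mult[of "\<lambda>y. F (x(p := y))" "F' x" "x p" UNIV "\<lambda>y. G (x(p := y))" "G' x"]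
    by (simp add: partial_at_def algebra_simps)
  then show ?thesis using assms by (auto simp: partial_at_def intro: tame_add tame_mult)
qed

lemma partial_at_sum:
  "(\<And>t. t \<in> T \<Longrightarrow> partial_at I p (F t) (F' t)) \<Longrightarrow>
    partial_at I p (\<lambda>x. \<Sum>t\<in>T. F t x) (\<lambda>x. \<Sum>t\<in>T. F' t x)"
  by (induction T rule: infinite_finite_induct) (auto intro: partial_at_add partial_at_const)

text \<open>Composition does not preserve exponential growth in general. Bounds on \<open>f\<close>
  and \<open>f'\<close> remove the growth of \<open>F\<close> from the outer factor, and solutions
  of Stein's equation supply exactly these bounds.\<close>

lemma partial_at_compose:
  assumes F: "partial_at I p F F'"
    and f: "\<And>y. (f has_real_derivative f' y) (at y)"
    and f'_meas: "f' \<in> borel_measurable borel"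
    and B: "\<And>y. \<bar>f y\<bar> \<le> B" and B': "\<And>y. \<bar>f' y\<bar> \<le> B'"
  shows "partial_at I p (\<lambda>x. f (F x)) (\<lambda>x. f' (F x) * F' x)"
proof -
  have f_meas: "f \<in> borel_measurable borel"
    using f by (intro borel_measurable_continuous_onI) (meson DERIV_isCont continuous_at_imp_continuous_on)
  have Fm: "F \<in> borel_measurable (gaussian_vector I)" and tF': "tame I F'"
    using F by (auto simp: partial_at_def tame_def)
  have "tame I (\<lambda>x. f (F x))"
    by (rule tame_bounded[OF measurable_compose[OF Fm f_meas] B])
  moreover have "tame I (\<lambda>x. f' (F x) * F' x)"
    by (rule tame_mult[OF tame_bounded[OF measurable_compose[OF Fm f'_meas] B'] tF'])
  moreover have "((\<lambda>y. f (F (x(p := y)))) has_real_derivative f' (F x) * F' x) (at (x p))" for x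
  proof -
    have "((\<lambda>y. F (x(p := y))) has_real_derivative F' x) (at (x p))"
      using F by (auto simp: partial_at_def)
    moreover have "(f has_real_derivative f' (F x)) (at (F (x(p := x p))))"
      using f by simp
    ultimately show ?thesis
      using DERIV_chain2[of f "f' (F x)" "\<lambda>y. F (x(p := y))" "x p" "F' x"] by simp
  qed
  ultimately show ?thesis by (simp add: partial_at_def)
qed

subsection \<open>Stein's equation\<close>

lemma emeasure_std_normal_uminus:
  assumes [measurable]: "S \<in> sets borel"
  shows "emeasure std_normal_distribution (uminus ` S) = emeasure std_normal_distribution S"
proof -
  have "uminus ` S = uminus -` S \<inter> space borel" by (force simp: image_def)
  also have "\<dots> \<in> sets borel" by measurable
  finally have [measurable]: "uminus ` S \<in> sets borel" .
  have "emeasure std_normal_distribution (uminus ` S)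
      = (\<integral>\<^sup>+y. ennreal (std_normal_density y) * indicator (uminus ` S) y \<partial>lborel)"
    by (simp add: emeasure_density)
  also have "\<dots> = (\<integral>\<^sup>+y. ennreal (std_normal_density (- y)) * indicator (uminus ` S) (- y) \<partial>lborel)"
    using nn_integral_real_affine[of "\<lambda>y. ennreal (std_normal_density y) * indicator (uminus ` S) y" "-1" 0]
    by simp
  also have "\<dots> = (\<integral>\<^sup>+y. ennreal (std_normal_density y) * indicator S y \<partial>lborel)"
    by (intro nn_integral_cong) (auto simp: std_normal_density_def indicator_def)
  also have "\<dots> = emeasure std_normal_distribution S"
    by (simp add: emeasure_density)
  finally show ?thesis .
qed

text \<open>On the tail \<open>x\<close> is at most the integration variable, and
  \<open>y * std_normal_density y\<close> has the antiderivative
  \<open>- std_normal_density y\<close>.\<close>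

lemma mills_ratio:
  assumes "0 \<le> x"
  shows "x * measure std_normal_distribution {x..} \<le> std_normal_density x"
proof -
  interpret prob_space std_normal_distribution by (rule prob_space_std_normal)
  have lim: "((\<lambda>y. - std_normal_density y) \<longlongrightarrow> 0) at_top"
    unfolding std_normal_density_def by real_asymp
  have "ennreal x * emeasure std_normal_distribution {x..}
      = (\<integral>\<^sup>+y. ennreal x * (ennreal (std_normal_density y) * indicator {x..} y) \<partial>lborel)"
    by (subst nn_integral_cmult) (simp_all add: emeasure_density)
  also have "\<dots> \<le> (\<integral>\<^sup>+y. ennreal (y * std_normal_density y) * indicator {x..} y \<partial>lborel)"
    using assms by (intro nn_integral_mono)
      (auto simp: indicator_def ennreal_mult[symmetric] intro!: ennreal_leI mult_right_mono)
  also have "\<dots> = ennreal (0 - (- std_normal_density x))"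
    using assms lim DERIV_minus[OF has_derivative_std_normal_density]
    by (intro nn_integral_FTC_atLeast[where T=0 and F="\<lambda>y. - std_normal_density y"]) auto
  finally show ?thesis
    using assms by (simp add: emeasure_eq_measure ennreal_mult[symmetric])
qed

text \<open>The first bound controls \<open>x * f x\<close> for the Stein solution, the second
  \<open>f x\<close> itself. For \<open>\<bar>x\<bar> \<le> 1\<close> the second holds because the
  tail is at most 1 and the density at least its value at 1; beyond that the first bound is already
  stronger.\<close>

lemma std_normal_tail:
  "\<bar>x\<bar> * measure std_normal_distribution {\<bar>x\<bar>..} \<le> std_normal_density x"
  "measure std_normal_distribution {\<bar>x\<bar>..} \<le> std_normal_density x / std_normal_density 1"
proof -
  interpret prob_space std_normal_distribution by (rule prob_space_std_normal)
  let ?t = "measure std_normal_distribution {\<bar>x\<bar>..}"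
  have even: "std_normal_density \<bar>x\<bar> = std_normal_density x" by (simp add: std_normal_density_def)
  then show 1: "\<bar>x\<bar> * ?t \<le> std_normal_density x" using mills_ratio[of "\<bar>x\<bar>"] by simp
  have p1: "0 < std_normal_density 1" by (intro normal_density_pos) simp
  show "?t \<le> std_normal_density x / std_normal_density 1"
  proof (cases "\<bar>x\<bar> \<le> 1")
    case True
    then have "x\<^sup>2 \<le> 1" by (simp add: abs_square_le_1)
    then have "std_normal_density 1 \<le> std_normal_density x"
      unfolding std_normal_density_def by (intro mult_left_mono) auto
    moreover have "?t * std_normal_density 1 \<le> 1 * std_normal_density 1"
      using p1 by (intro mult_right_mono) auto
    ultimately have "?t * std_normal_density 1 \<le> std_normal_density x" by linarith
    then show ?thesis using p1 by (simp add: pos_le_divide_eq)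
  next
    case False
    have "sqrt (2 * pi) \<ge> 1" using pi_gt3 by simp
    then have "std_normal_density 1 \<le> 1"
      by (simp add: std_normal_density_def divide_le_eq order_trans[of _ 1])
    have "?t * std_normal_density 1 \<le> ?t * 1"
      using \<open>std_normal_density 1 \<le> 1\<close> by (intro mult_left_mono) auto
    also have "\<dots> \<le> \<bar>x\<bar> * ?t" using False by (simp add: mult_right_le_one_le mult_le_cancel_right1)
    finally show ?thesis using 1 p1 by (simp add: pos_le_divide_eq)
  qed
qed

text \<open>The solution is the integral of the centred function against the Gaussian up to
  \<open>x\<close>, divided by the density. The tail bounds control the quotient, and
  \<open>4 * B\<close> is the sum of \<open>2 * B\<close> for the centred function and
  \<open>2 * B\<close> for \<open>x * f x\<close>.\<close>

lemma stein_equation: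
  fixes v :: "real \<Rightarrow> real"
  assumes v: "continuous_on UNIV v" and B: "\<And>x. \<bar>v x\<bar> \<le> B"
  obtains f f' where "\<And>x. (f has_real_derivative f' x) (at x)"
    "\<And>x. f' x - x * f x = v x - (\<integral>z. v z \<partial>std_normal_distribution)"
    "\<And>x. \<bar>f x\<bar> \<le> 2 * B / std_normal_density 1" "\<And>x. \<bar>f' x\<bar> \<le> 4 * B"
    "f' \<in> borel_measurable borel"
proof -
  interpret prob_space std_normal_distribution by (rule prob_space_std_normal)
  let ?G = "std_normal_distribution" and ?\<rho> = "std_normal_density"
  have [measurable]: "v \<in> borel_measurable borel" by (rule borel_measurable_continuous_onI[OF v])
  have v_int: "integrable ?G v"
    by (rule integrable_const_bound[where B=B]) (use B in auto)
  define m where "m = (\<integral>z. v z \<partial>?G)"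
  have m_le: "\<bar>m\<bar> \<le> B"
  proof -
    have "\<bar>m\<bar> \<le> (\<integral>z. \<bar>v z\<bar> \<partial>?G)" unfolding m_def by (rule integral_abs_bound)
    also have "\<dots> \<le> (\<integral>z. B \<partial>?G)" by (intro integral_mono integrable_abs v_int B) auto
    finally show ?thesis using prob_space by simp
  qed
  define w where "w x = v x - m" for x
  have [measurable]: "w \<in> borel_measurable borel" unfolding w_def by measurable
  have w_le: "\<bar>w x\<bar> \<le> 2 * B" for x using B[of x] m_le by (auto simp: w_def)
  have w_int: "integrable ?G w" unfolding w_def using v_int by auto
  have w_mean: "(\<integral>z. w z \<partial>?G) = 0" unfolding w_def using v_int prob_space by (simp add: m_def)
  define H where "H x = (\<integral>y. indicator {..x} y * w y \<partial>?G)" for x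
  have i_int: "integrable ?G (\<lambda>y. indicator S y * w y)" if "S \<in> sets borel" for S
    using integrable_mult_indicator[OF _ w_int, of S] that by simp
  have H_set: "\<bar>\<integral>y. indicator S y * w y \<partial>?G\<bar> \<le> 2 * B * measure ?G S" if S[measurable]: "S \<in> sets borel" for S
  proof -
    have "\<bar>\<integral>y. indicator S y * w y \<partial>?G\<bar> \<le> (\<integral>y. \<bar>indicator S y * w y\<bar> \<partial>?G)" by (rule integral_abs_bound)
    also have "\<dots> \<le> (\<integral>y. 2 * B * indicator S y \<partial>?G)"
      by (intro integral_mono integrable_abs i_int integrable_mult_right integrable_real_indicator)
        (use w_le in \<open>auto simp: indicator_def emeasure_eq_measure\<close>)
    finally show ?thesis by simp
  qed
  \<comment> \<open>Because \<open>w\<close> has mean zero, the integral up to \<open>x\<close> can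
    be traded for the upper tail. Without this the bound on \<open>H\<close> would not decay for
    large positive \<open>x\<close>.\<close>
  have H_compl: "H x = - (\<integral>y. indicator {x<..} y * w y \<partial>?G)" for x
  proof -
    have "H x + (\<integral>y. indicator {x<..} y * w y \<partial>?G) = (\<integral>y. w y \<partial>?G)"
      unfolding H_def
      by (subst Bochner_Integration.integral_add[OF i_int i_int, symmetric])
        (auto intro!: Bochner_Integration.integral_cong simp: indicator_def)
    then show ?thesis using w_mean by simp
  qed
  have B0: "0 \<le> B" using B[of 0] by linarith
  have H_le: "\<bar>H x\<bar> \<le> 2 * B * measure ?G {\<bar>x\<bar>..}" for x
  proof (cases "0 \<le> x")
    case True
    have "\<bar>H x\<bar> \<le> 2 * B * measure ?G {x<..}" using H_set[of "{x<..}"] by (simp add: H_compl)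
    also have "\<dots> \<le> 2 * B * measure ?G {\<bar>x\<bar>..}"
      using B0 True by (intro mult_left_mono finite_measure_mono) auto
    finally show ?thesis .
  next
    case False
    have "uminus ` {\<bar>x\<bar>..} = {..x}" using False by (auto simp: image_def intro: bexI[of _ "- _"])
    then have "measure ?G {..x} = measure ?G {\<bar>x\<bar>..}"
      using emeasure_std_normal_uminus[of "{\<bar>x\<bar>..}"] by (simp add: measure_def)
    then show ?thesis using H_set[of "{..x}"] by (simp add: H_def)
  qed
  define g where "g x = ?\<rho> x * w x" for x
  have rho_cont: "continuous_on UNIV ?\<rho>"
    using has_derivative_std_normal_density DERIV_isCont continuous_at_imp_continuous_on by blast
  have g_cont: "continuous_on UNIV g"
    unfolding g_def w_def by (intro continuous_intros rho_cont v)
  \<comment> \<open>\<open>H\<close> starts at minus infinity, so its derivative is obtained by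
    comparison: its increments agree with those of an antiderivative of the continuous function
    \<open>g\<close>, hence the two differ by a constant.\<close>
  obtain F where F: "(F has_vector_derivative g x) (at x)" for x
    using einterval_antiderivative[of "-\<infinity>" "\<infinity>" g] g_cont
    by (auto simp: continuous_on_eq_continuous_at)
  have H_diff: "H y - H x = F y - F x" if "x \<le> y" for x y
  proof -
    have "H y - H x = (\<integral>t. indicator {x<..y} t * w t \<partial>?G)"
      unfolding H_def using that
      by (subst Bochner_Integration.integral_diff[OF i_int i_int, symmetric])
        (auto intro!: Bochner_Integration.integral_cong simp: indicator_def)
    also have "\<dots> = (\<integral>t. ?\<rho> t *\<^sub>R (indicator {x<..y} t * w t) \<partial>lborel)"
      by (subst integral_density) auto
    also have "\<dots> = (\<integral>t. indicator {x..y} t *\<^sub>R g t \<partial>lborel)"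
    \<comment> \<open>The difference of two lower integrals lives on a half-open interval, the
      fundamental theorem on a closed one; they differ by the null set \<open>{x}\<close>.\<close>
    proof (rule integral_cong_AE)
      show "AE t in lborel. ?\<rho> t *\<^sub>R (indicator {x<..y} t * w t) = indicator {x..y} t *\<^sub>R g t"
        using AE_lborel_singleton[of x] by eventually_elim (auto simp: g_def indicator_def)
    qed (auto simp: g_def)
    also have "\<dots> = F y - F x"
      by (rule integral_FTC_atLeastAtMost[OF that])
        (auto intro: has_vector_derivative_at_within F continuous_on_subset[OF g_cont])
    finally show ?thesis .
  qed
  have H_eq: "H x = F x + (H 0 - F 0)" for x
    using H_diff[of 0 x] H_diff[of x 0] by (cases "0 \<le> x") auto
  have dH: "(H has_real_derivative g x) (at x)" for x
  proof -
    have "(F has_real_derivative g x) (at x)"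
      using F by (simp only: has_real_derivative_iff_has_vector_derivative)
    from DERIV_add[OF this DERIV_const[of "H 0 - F 0"]]
    have "((\<lambda>x. F x + (H 0 - F 0)) has_real_derivative g x) (at x)" by simp
    moreover have "H = (\<lambda>x. F x + (H 0 - F 0))" by (rule ext) (rule H_eq)
    ultimately show ?thesis by metis
  qed
  have \<rho>_pos: "0 < ?\<rho> x" for x by (intro normal_density_pos) simp
  define f where "f x = H x / ?\<rho> x" for x
  have df: "(f has_real_derivative w x + x * f x) (at x)" for x
  proof -
    have "(f has_real_derivative (g x * ?\<rho> x - H x * - (x * ?\<rho> x)) / (?\<rho> x * ?\<rho> x)) (at x)"
      unfolding f_def using \<rho>_pos[of x]
      by (intro DERIV_divide dH has_derivative_std_normal_density) auto
    moreover have "(g x * ?\<rho> x - H x * - (x * ?\<rho> x)) / (?\<rho> x * ?\<rho> x) = w x + x * f x"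
      using \<rho>_pos[of x] by (simp add: g_def f_def field_simps)
    ultimately show ?thesis by simp
  qed
  have f_le: "\<bar>f x\<bar> \<le> 2 * B / ?\<rho> 1" for x
  proof -
    have "\<bar>H x\<bar> \<le> 2 * B * (?\<rho> x / ?\<rho> 1)"
      by (rule order_trans[OF H_le mult_left_mono[OF std_normal_tail(2)]]) (use B0 in auto)
    then show ?thesis using \<rho>_pos[of x] \<rho>_pos[of 1] by (simp add: f_def field_simps)
  qed
  have xf_le: "\<bar>x * f x\<bar> \<le> 2 * B" for x
  proof -
    have "\<bar>x\<bar> * \<bar>H x\<bar> \<le> \<bar>x\<bar> * (2 * B * measure ?G {\<bar>x\<bar>..})"
      by (intro mult_left_mono H_le) auto
    also have "\<dots> = 2 * B * (\<bar>x\<bar> * measure ?G {\<bar>x\<bar>..})" by simp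
    also have "\<dots> \<le> 2 * B * ?\<rho> x"
      using B0 by (intro mult_left_mono std_normal_tail) auto
    finally show ?thesis using \<rho>_pos[of x] by (simp add: f_def abs_mult field_simps)
  qed
  have [measurable]: "f \<in> borel_measurable borel"
    using df by (intro borel_measurable_continuous_onI) (meson DERIV_isCont continuous_at_imp_continuous_on)
  show ?thesis
  proof (rule that[OF df])
    show "\<bar>w x + x * f x\<bar> \<le> 4 * B" for x using w_le[of x] xf_le[of x] by linarith
  qed (auto simp: f_le w_def m_def[symmetric])
qed

subsection \<open>Passage from continuous to measurable test functions\<close>

text \<open>Inner regularity by compact sets is applied to \<open>S\<close> and to its complement;
  the complement of the second set is the open superset.\<close>

lemma closed_open_approximation:
  fixes M :: "real measure"
  assumes M: "prob_space M" and sets: "sets M = sets borel" and S: "S \<in> sets borel" and e: "0 < e"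
  obtains C U where "closed C" "open U" "C \<subseteq> S" "S \<subseteq> U" "measure M (U - C) < e"
proof -
  interpret prob_space M by fact
  have inner: "\<exists>K. closed K \<and> K \<subseteq> T \<and> measure M (T - K) < e / 2" if T: "T \<in> sets borel" for T
  proof (cases "measure M T < e / 2")
    \<comment> \<open>Subtracting \<open>e / 2\<close> would give a negative number, which
      \<open>ennreal\<close> truncates to 0, and the strict inequality needed for the supremum fails
      on null sets. The empty set serves instead.\<close>
    case True
    then show ?thesis by (intro exI[of _ "{}"]) auto
  next
    case False
    have "ennreal (measure M T - e / 2) < emeasure M T"
      using False e by (simp add: emeasure_eq_measure ennreal_less_iff)
    also have "\<dots> = (SUP K \<in> {K. K \<subseteq> T \<and> compact K}. emeasure M K)"
      by (rule inner_regular[OF sets _ T]) simp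
    finally obtain K where K: "K \<subseteq> T" "compact K" "ennreal (measure M T - e / 2) < emeasure M K"
      by (auto simp: less_SUP_iff)
    then have "measure M T - e / 2 < measure M K"
      using False by (simp add: emeasure_eq_measure ennreal_less_iff)
    moreover have "measure M (T - K) = measure M T - measure M K"
      using K T by (intro finite_measure_Diff) (auto simp: sets compact_imp_closed)
    ultimately show ?thesis using K compact_imp_closed by (intro exI[of _ K]) auto
  qed
  obtain C where C: "closed C" "C \<subseteq> S" "measure M (S - C) < e / 2" using inner[OF S] by blast
  obtain D where D: "closed D" "D \<subseteq> - S" "measure M (- S - D) < e / 2" using inner[of "- S"] S by auto
  have "- D - C = (S - C) \<union> (- S - D)" using C D by auto
  then have "measure M (- D - C) \<le> measure M (S - C) + measure M (- S - D)"
    using C D S by (auto intro!: measure_Un_le simp: sets)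
  then show ?thesis using C D by (intro that[of C "- D"]) auto
qed

text \<open>One function \<open>c\<close> has to serve both measures, since the estimate for
  continuous functions compares two integrals of the same function. The bound \<open>b\<close> only
  ensures integrability.\<close>

definition approximable :: "real measure \<Rightarrow> real measure \<Rightarrow> (real \<Rightarrow> real) \<Rightarrow> bool" where
  "approximable M N u \<longleftrightarrow> (\<forall>e>0. \<exists>c b. continuous_on UNIV c \<and> (\<forall>x. \<bar>c x\<bar> \<le> b) \<and>
     (\<integral>x. \<bar>u x - c x\<bar> \<partial>M) < e \<and> (\<integral>x. \<bar>u x - c x\<bar> \<partial>N) < e)"

text \<open>Induction over nonnegative measurable functions, with boundedness as a premise of the
  claim. It passes down to both summands and to every member of an increasing sequence because all
  functions involved are nonnegative.\<close>

lemma bounded_measurable_approximable: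
  fixes M N :: "real measure"
  assumes M: "prob_space M" and N: "prob_space N" and sM: "sets M = sets borel" and sN: "sets N = sets borel"
    and u: "u \<in> borel_measurable borel" and nn: "\<And>x. 0 \<le> u x" and bdd: "\<And>x. u x \<le> b"
  shows "approximable M N u"
proof -
  interpret M: prob_space M by fact
  interpret N: prob_space N by fact
  note [measurable_cong] = sM sN
  have iM: "integrable M h" "integrable N h" if "h \<in> borel_measurable borel" "\<And>x. \<bar>h x\<bar> \<le> k" for h :: "real \<Rightarrow> real" and k
    using that by (auto intro!: M.integrable_const_bound[where B=k] N.integrable_const_bound[where B=k]
        simp: measurable_cong_sets[OF sM refl] measurable_cong_sets[OF sN refl])
  have "(\<exists>b. \<forall>x. u x \<le> b) \<longrightarrow> approximable M N u"
    using u nn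
  proof (induction rule: borel_measurable_induct_real)
    case (set S)
    have "\<exists>c b. continuous_on UNIV c \<and> (\<forall>x. \<bar>c x\<bar> \<le> b) \<and>
        (\<integral>x. \<bar>indicator S x - c x\<bar> \<partial>M) < e \<and> (\<integral>x. \<bar>indicator S x - c x\<bar> \<partial>N) < e" if e: "0 < e" for e :: real
    proof -
      obtain C1 U1 where 1: "closed C1" "open U1" "C1 \<subseteq> S" "S \<subseteq> U1" "measure M (U1 - C1) < e"
        by (rule closed_open_approximation[OF M sM _ e]) (use set in auto)
      obtain C2 U2 where 2: "closed C2" "open U2" "C2 \<subseteq> S" "S \<subseteq> U2" "measure N (U2 - C2) < e"
        by (rule closed_open_approximation[OF N sN _ e]) (use set in auto)
      \<comment> \<open>The union of the closed sets and the intersection of the open sets still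
        enclose \<open>S\<close>, and \<open>U - C\<close> lies inside both differences, so one
        Urysohn function is good for both measures.\<close>
      define C U where "C = C1 \<union> C2" and "U = U1 \<inter> U2"
      have CU: "closed C" "open U" "C \<subseteq> S" "S \<subseteq> U" using 1 2 by (auto simp: C_def U_def)
      obtain c :: "real \<Rightarrow> real" where c: "continuous_on UNIV c" "\<And>x. c x \<in> closed_segment 0 1"
          "\<And>x. x \<in> - U \<Longrightarrow> c x = 0" "\<And>x. x \<in> C \<Longrightarrow> c x = 1"
        using Urysohn[of "- U" C "0::real" "1::real"] CU by blast
      have c01: "0 \<le> c x" "c x \<le> 1" for x using c(2)[of x] by (auto simp: closed_segment_eq_real_ivl)
      have [measurable]: "c \<in> borel_measurable borel" by (rule borel_measurable_continuous_onI[OF c(1)])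
      have [measurable]: "S \<in> sets borel" "U - C \<in> sets borel" "U \<in> sets borel" "C \<in> sets borel"
        using set CU by auto
      have le: "\<bar>indicator S x - c x\<bar> \<le> indicator (U - C) x" for x
        using c01[of x] c(3,4)[of x] CU by (auto simp: indicator_def)
      have b1: "\<bar>indicator S x - c x\<bar> \<le> 1" for x using c01[of x] by (auto simp: indicator_def)
      have b2: "\<bar>indicator (U - C) x :: real\<bar> \<le> 1" for x by (auto simp: indicator_def)
      have "(\<integral>x. \<bar>indicator S x - c x\<bar> \<partial>M) \<le> (\<integral>x. indicator (U - C) x \<partial>M)"
        by (rule integral_mono[OF integrable_abs[OF iM(1)[OF _ b1]] iM(1)[OF _ b2] le]) measurable
      also have "\<dots> = measure M (U - C)" using sets_eq_imp_space_eq[OF sM] by simp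
      also have "\<dots> \<le> measure M (U1 - C1)"
        using 1 2 by (intro M.finite_measure_mono) (auto simp: C_def U_def sM)
      finally have m: "(\<integral>x. \<bar>indicator S x - c x\<bar> \<partial>M) < e" using 1 by simp
      have "(\<integral>x. \<bar>indicator S x - c x\<bar> \<partial>N) \<le> (\<integral>x. indicator (U - C) x \<partial>N)"
        by (rule integral_mono[OF integrable_abs[OF iM(2)[OF _ b1]] iM(2)[OF _ b2] le]) measurable
      also have "\<dots> = measure N (U - C)" using sets_eq_imp_space_eq[OF sN] by simp
      also have "\<dots> \<le> measure N (U2 - C2)"
        using 1 2 by (intro N.finite_measure_mono) (auto simp: C_def U_def sN)
      finally have n: "(\<integral>x. \<bar>indicator S x - c x\<bar> \<partial>N) < e" using 2 by simp
      show ?thesis using c(1) c01 m n by (intro exI[of _ c] exI[of _ 1]) auto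
    qed
    then show ?case by (auto simp: approximable_def)
  next
    case (mult u k)
    show ?case
    \<comment> \<open>For \<open>k = 0\<close> boundedness of the product says nothing about
      \<open>u\<close>, so the induction hypothesis is out of reach; the zero function approximates
      directly.\<close>
    proof (cases "k = 0")
      case True
      then show ?thesis by (auto simp: approximable_def intro!: exI[of _ "\<lambda>_. 0"] exI[of _ 0])
    next
      case False
      with mult have k: "0 < k" by simp
      show ?thesis
      proof
        assume "\<exists>b. \<forall>x. k * u x \<le> b"
        then obtain b where "\<forall>x. k * u x \<le> b" by blast
        then have "\<forall>x. u x \<le> b / k" using k by (simp add: field_simps)
        then have ap: "approximable M N u" using mult by blast
        show "approximable M N (\<lambda>x. k * u x)"
          unfolding approximable_def
        proof (intro allI impI)
          fix e :: real assume "0 < e"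
          then have "0 < e / k" using k by simp
          then obtain c b where c: "continuous_on UNIV c" "\<forall>x. \<bar>c x\<bar> \<le> b"
            "(\<integral>x. \<bar>u x - c x\<bar> \<partial>M) < e / k" "(\<integral>x. \<bar>u x - c x\<bar> \<partial>N) < e / k"
            using ap unfolding approximable_def by blast
          have "\<bar>k * u x - k * c x\<bar> = k * \<bar>u x - c x\<bar>" for x
            using k by (simp add: right_diff_distrib[symmetric] abs_mult)
          moreover have "\<bar>k * c x\<bar> \<le> k * b" for x using k c(2) by (simp add: abs_mult)
          ultimately show "\<exists>c b. continuous_on UNIV c \<and> (\<forall>x. \<bar>c x\<bar> \<le> b) \<and>
              (\<integral>x. \<bar>k * u x - c x\<bar> \<partial>M) < e \<and> (\<integral>x. \<bar>k * u x - c x\<bar> \<partial>N) < e"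
            using c k by (intro exI[of _ "\<lambda>x. k * c x"] exI[of _ "k * b"])
              (auto intro!: continuous_intros simp: field_simps)
        qed
      qed
    qed
  next
    case (add u v)
    show ?case
    proof
      assume "\<exists>b. \<forall>x. v x + u x \<le> b"
      then obtain b0 where b0: "\<forall>x. v x + u x \<le> b0" by blast
      have nneg: "0 \<le> u x" "0 \<le> v x" for x by (rule add.hyps)+
      have ub: "\<forall>x. u x \<le> b0" "\<forall>x. v x \<le> b0"
      proof -
        have "u x \<le> b0 \<and> v x \<le> b0" for x using b0[rule_format, of x] nneg[of x] by linarith
        then show "\<forall>x. u x \<le> b0" "\<forall>x. v x \<le> b0" by auto
      qed
      then have ap: "approximable M N u" "approximable M N v" using add by blast+
      show "approximable M N (\<lambda>x. v x + u x)"
        unfolding approximable_def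
      proof (intro allI impI)
        fix e :: real assume "0 < e"
        then have e2: "0 < e / 2" by simp
        obtain c b where c: "continuous_on UNIV c" "\<forall>x. \<bar>c x\<bar> \<le> b"
          "(\<integral>x. \<bar>u x - c x\<bar> \<partial>M) < e / 2" "(\<integral>x. \<bar>u x - c x\<bar> \<partial>N) < e / 2"
          using ap(1) e2 unfolding approximable_def by blast
        obtain d b' where d: "continuous_on UNIV d" "\<forall>x. \<bar>d x\<bar> \<le> b'"
          "(\<integral>x. \<bar>v x - d x\<bar> \<partial>M) < e / 2" "(\<integral>x. \<bar>v x - d x\<bar> \<partial>N) < e / 2"
          using ap(2) e2 unfolding approximable_def by blast
        have [measurable]: "c \<in> borel_measurable borel" "d \<in> borel_measurable borel"
          by (auto intro: borel_measurable_continuous_onI c d)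
        have [measurable]: "u \<in> borel_measurable borel" "v \<in> borel_measurable borel" using add by auto
        have bu: "\<bar>u x - c x\<bar> \<le> b0 + b" "\<bar>v x - d x\<bar> \<le> b0 + b'"
          "\<bar>(v x + u x) - (d x + c x)\<bar> \<le> 2 * b0 + b + b'" for x
          using ub[rule_format, of x] c(2)[rule_format, of x] d(2)[rule_format, of x] nneg[of x]
          by (auto simp: abs_le_iff)
        have tri: "\<bar>(v x + u x) - (d x + c x)\<bar> \<le> \<bar>u x - c x\<bar> + \<bar>v x - d x\<bar>" for x by linarith
        have "(\<integral>x. \<bar>(v x + u x) - (d x + c x)\<bar> \<partial>M) \<le> (\<integral>x. \<bar>u x - c x\<bar> + \<bar>v x - d x\<bar> \<partial>M)"
          by (rule integral_mono[OF integrable_abs[OF iM(1)[OF _ bu(3)]] Bochner_Integration.integrable_add[OF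
                integrable_abs[OF iM(1)[OF _ bu(1)]] integrable_abs[OF iM(1)[OF _ bu(2)]]] tri]) measurable
        also have "\<dots> = (\<integral>x. \<bar>u x - c x\<bar> \<partial>M) + (\<integral>x. \<bar>v x - d x\<bar> \<partial>M)"
          by (rule Bochner_Integration.integral_add[OF integrable_abs[OF iM(1)[OF _ bu(1)]] integrable_abs[OF iM(1)[OF _ bu(2)]]]) measurable
        finally have m: "(\<integral>x. \<bar>(v x + u x) - (d x + c x)\<bar> \<partial>M) < e" using c d by simp
        have "(\<integral>x. \<bar>(v x + u x) - (d x + c x)\<bar> \<partial>N) \<le> (\<integral>x. \<bar>u x - c x\<bar> + \<bar>v x - d x\<bar> \<partial>N)"
          by (rule integral_mono[OF integrable_abs[OF iM(2)[OF _ bu(3)]] Bochner_Integration.integrable_add[OF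
                integrable_abs[OF iM(2)[OF _ bu(1)]] integrable_abs[OF iM(2)[OF _ bu(2)]]] tri]) measurable
        also have "\<dots> = (\<integral>x. \<bar>u x - c x\<bar> \<partial>N) + (\<integral>x. \<bar>v x - d x\<bar> \<partial>N)"
          by (rule Bochner_Integration.integral_add[OF integrable_abs[OF iM(2)[OF _ bu(1)]] integrable_abs[OF iM(2)[OF _ bu(2)]]]) measurable
        finally have n: "(\<integral>x. \<bar>(v x + u x) - (d x + c x)\<bar> \<partial>N) < e" using c d by simp
        have dc: "\<forall>x. \<bar>d x + c x\<bar> \<le> b' + b" using c(2) d(2) by (metis abs_triangle_ineq add_mono order_trans)
        have dc': "continuous_on UNIV (\<lambda>x. d x + c x)" by (intro continuous_intros c(1) d(1))
        show "\<exists>c b. continuous_on UNIV c \<and> (\<forall>x. \<bar>c x\<bar> \<le> b) \<and>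
            (\<integral>x. \<bar>(v x + u x) - c x\<bar> \<partial>M) < e \<and> (\<integral>x. \<bar>(v x + u x) - c x\<bar> \<partial>N) < e"
          by (rule exI[of _ "\<lambda>x. d x + c x"], rule exI[of _ "b' + b"], intro conjI) (fact dc' dc m n)+
      qed
    qed
  next
    case (seq V)
    show ?case
    proof
      assume "\<exists>b. \<forall>x. u x \<le> b"
      then obtain b0 where b0: "\<forall>x. u x \<le> b0" by blast
      have lim: "(\<lambda>i. V i x) \<longlonglongrightarrow> u x" for x using seq by simp
      have V0: "0 \<le> V i x" for i x by (rule seq.hyps)
      \<comment> \<open>An increasing sequence stays below its limit, so the bound on
        \<open>u\<close> holds for every \<open>V i\<close>; it opens the induction hypothesis and
        serves as dominating constant.\<close>
      have Vu: "V i x \<le> u x" for i x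
        using seq.hyps by (intro incseq_le[OF _ lim]) (auto simp: incseq_def le_fun_def)
      have [measurable]: "V i \<in> borel_measurable borel" for i using seq by auto
      have [measurable]: "u \<in> borel_measurable borel" by (rule borel_measurable_LIMSEQ_real[of _ V]) (use lim in auto)
      have ub: "0 \<le> u x" "u x \<le> b0" for x using nn b0 by auto
      have Vb: "\<bar>u x - V i x\<bar> \<le> b0" for i x
        using Vu[of i x] V0[of i x] ub[of x] by linarith
      have abs0: "(\<lambda>i. \<bar>u x - V i x\<bar>) \<longlonglongrightarrow> 0" for x
        using tendsto_rabs[OF tendsto_diff[OF tendsto_const[of "u x"] lim[of x]]] by simp
      have lM: "(\<lambda>i. \<integral>x. \<bar>u x - V i x\<bar> \<partial>M) \<longlonglongrightarrow> (\<integral>x. 0 \<partial>M)"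
        by (rule integral_dominated_convergence[where w="\<lambda>_. b0"]) (use abs0 Vb in auto)
      have lN: "(\<lambda>i. \<integral>x. \<bar>u x - V i x\<bar> \<partial>N) \<longlonglongrightarrow> (\<integral>x. 0 \<partial>N)"
        by (rule integral_dominated_convergence[where w="\<lambda>_. b0"]) (use abs0 Vb in auto)
      show "approximable M N u"
        unfolding approximable_def
      proof (intro allI impI)
        fix e :: real assume "0 < e"
        then have e2: "0 < e / 2" by simp
        have "\<forall>\<^sub>F i in sequentially. (\<integral>x. \<bar>u x - V i x\<bar> \<partial>M) < e / 2 \<and> (\<integral>x. \<bar>u x - V i x\<bar> \<partial>N) < e / 2"
          using order_tendstoD(2)[OF lM, of "e / 2"] order_tendstoD(2)[OF lN, of "e / 2"] e2
          by (auto intro: eventually_conj)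
        then obtain i where i: "(\<integral>x. \<bar>u x - V i x\<bar> \<partial>M) < e / 2" "(\<integral>x. \<bar>u x - V i x\<bar> \<partial>N) < e / 2"
          using eventually_sequentially by auto
        have "approximable M N (V i)" using seq.IH[of i] Vu ub(2) order_trans by blast
        then obtain c b where c: "continuous_on UNIV c" "\<forall>x. \<bar>c x\<bar> \<le> b"
          "(\<integral>x. \<bar>V i x - c x\<bar> \<partial>M) < e / 2" "(\<integral>x. \<bar>V i x - c x\<bar> \<partial>N) < e / 2"
          using e2 unfolding approximable_def by blast
        have [measurable]: "c \<in> borel_measurable borel" by (rule borel_measurable_continuous_onI[OF c(1)])
        have bu: "\<bar>V i x - c x\<bar> \<le> b0 + b" "\<bar>u x - c x\<bar> \<le> b0 + b" for x
          using Vu[of i x] V0[of i x] ub[of x] c(2)[rule_format, of x] by (auto simp: abs_le_iff)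
        have tri: "\<bar>u x - c x\<bar> \<le> \<bar>u x - V i x\<bar> + \<bar>V i x - c x\<bar>" for x by linarith
        have "(\<integral>x. \<bar>u x - c x\<bar> \<partial>M) \<le> (\<integral>x. \<bar>u x - V i x\<bar> + \<bar>V i x - c x\<bar> \<partial>M)"
          by (rule integral_mono[OF integrable_abs[OF iM(1)[OF _ bu(2)]] Bochner_Integration.integrable_add[OF
                integrable_abs[OF iM(1)[OF _ Vb]] integrable_abs[OF iM(1)[OF _ bu(1)]]] tri]) measurable
        also have "\<dots> = (\<integral>x. \<bar>u x - V i x\<bar> \<partial>M) + (\<integral>x. \<bar>V i x - c x\<bar> \<partial>M)"
          by (rule Bochner_Integration.integral_add[OF integrable_abs[OF iM(1)[OF _ Vb]] integrable_abs[OF iM(1)[OF _ bu(1)]]]) measurable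
        finally have m: "(\<integral>x. \<bar>u x - c x\<bar> \<partial>M) < e" using c i by simp
        have "(\<integral>x. \<bar>u x - c x\<bar> \<partial>N) \<le> (\<integral>x. \<bar>u x - V i x\<bar> + \<bar>V i x - c x\<bar> \<partial>N)"
          by (rule integral_mono[OF integrable_abs[OF iM(2)[OF _ bu(2)]] Bochner_Integration.integrable_add[OF
                integrable_abs[OF iM(2)[OF _ Vb]] integrable_abs[OF iM(2)[OF _ bu(1)]]] tri]) measurable
        also have "\<dots> = (\<integral>x. \<bar>u x - V i x\<bar> \<partial>N) + (\<integral>x. \<bar>V i x - c x\<bar> \<partial>N)"
          by (rule Bochner_Integration.integral_add[OF integrable_abs[OF iM(2)[OF _ Vb]] integrable_abs[OF iM(2)[OF _ bu(1)]]]) measurable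
        finally have n: "(\<integral>x. \<bar>u x - c x\<bar> \<partial>N) < e" using c i by simp
        show "\<exists>c b. continuous_on UNIV c \<and> (\<forall>x. \<bar>c x\<bar> \<le> b) \<and>
            (\<integral>x. \<bar>u x - c x\<bar> \<partial>M) < e \<and> (\<integral>x. \<bar>u x - c x\<bar> \<partial>N) < e"
          using c m n by blast
      qed
    qed
  qed
  with bdd show ?thesis by blast
qed

text \<open>The constant \<open>K\<close> is tied to the bound \<open>B\<close>, so the
  approximating functions must respect the very same \<open>B\<close>; otherwise the constant would
  deteriorate.\<close>

lemma integral_diff_bound_from_continuous:
  fixes M N :: "real measure" and B K :: real
  assumes M: "prob_space M" and N: "prob_space N" and sM: "sets M = sets borel" and sN: "sets N = sets borel"
    and K: "\<And>v. continuous_on UNIV v \<Longrightarrow> (\<And>x::real. \<bar>v x\<bar> \<le> B) \<Longrightarrow> \<bar>(\<integral>x. v x \<partial>M) - (\<integral>x. v x \<partial>N)\<bar> \<le> K"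
    and u: "u \<in> borel_measurable borel" and B: "\<And>x. \<bar>u x\<bar> \<le> B"
  shows "\<bar>(\<integral>x. u x \<partial>M) - (\<integral>x. u x \<partial>N)\<bar> \<le> K"
proof (rule field_le_epsilon)
  fix e :: real assume "0 < e"
  then have e2: "0 < e / 2" by simp
  interpret M: prob_space M by fact
  interpret N: prob_space N by fact
  note [measurable_cong] = sM sN
  note [measurable] = u
  have iM: "integrable M h" "integrable N h" if "h \<in> borel_measurable borel" "\<And>x. \<bar>h x\<bar> \<le> k" for h :: "real \<Rightarrow> real" and k
    using that by (auto intro!: M.integrable_const_bound[where B=k] N.integrable_const_bound[where B=k]
        simp: measurable_cong_sets[OF sM refl] measurable_cong_sets[OF sN refl])
  have "0 \<le> u x + B" "u x + B \<le> 2 * B" for x using B[of x] by linarith+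
  then have "approximable M N (\<lambda>x. u x + B)"
    by (intro bounded_measurable_approximable[where b="2*B"] M N sM sN) auto
  then obtain c b where c: "continuous_on UNIV c" "\<forall>x. \<bar>c x\<bar> \<le> b"
    "(\<integral>x. \<bar>u x + B - c x\<bar> \<partial>M) < e / 2" "(\<integral>x. \<bar>u x + B - c x\<bar> \<partial>N) < e / 2"
    using e2 unfolding approximable_def by blast
  \<comment> \<open>Shifting back by \<open>B\<close> undoes the translation that made
    \<open>u\<close> nonnegative. Clamping to \<open>[- B, B]\<close> brings no point farther from
    \<open>u\<close>, whose values lie in that interval.\<close>
  define v where "v x = max (- B) (min B (c x - B))" for x
  have v: "continuous_on UNIV v" unfolding v_def by (intro continuous_intros c(1))
  have [measurable]: "c \<in> borel_measurable borel" "v \<in> borel_measurable borel"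
    by (auto intro: borel_measurable_continuous_onI c v)
  have vB: "\<bar>v x\<bar> \<le> B" for x
    using abs_le_D1[OF B[of x]] abs_le_D2[OF B[of x]] unfolding v_def by linarith
  have uv: "\<bar>u x - v x\<bar> \<le> \<bar>u x + B - c x\<bar>" for x
    using abs_le_D1[OF B[of x]] abs_le_D2[OF B[of x]] unfolding v_def by linarith
  have cb: "\<bar>u x + B - c x\<bar> \<le> 2 * B + b" for x using B[of x] c(2)[rule_format, of x] by (auto simp: abs_le_iff)
  have uvb: "\<bar>u x - v x\<bar> \<le> 2 * B" for x using B[of x] vB[of x] by linarith
  have "\<bar>(\<integral>x. u x \<partial>M) - (\<integral>x. v x \<partial>M)\<bar> = \<bar>\<integral>x. u x - v x \<partial>M\<bar>"
    by (subst Bochner_Integration.integral_diff[OF iM(1)[OF _ B] iM(1)[OF _ vB]]) auto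
  also have "\<dots> \<le> (\<integral>x. \<bar>u x - v x\<bar> \<partial>M)" by (rule integral_abs_bound)
  also have "\<dots> \<le> (\<integral>x. \<bar>u x + B - c x\<bar> \<partial>M)"
    by (rule integral_mono[OF integrable_abs[OF iM(1)[OF _ uvb]] integrable_abs[OF iM(1)[OF _ cb]] uv]) measurable
  finally have m: "\<bar>(\<integral>x. u x \<partial>M) - (\<integral>x. v x \<partial>M)\<bar> < e / 2" using c by simp
  have "\<bar>(\<integral>x. u x \<partial>N) - (\<integral>x. v x \<partial>N)\<bar> = \<bar>\<integral>x. u x - v x \<partial>N\<bar>"
    by (subst Bochner_Integration.integral_diff[OF iM(2)[OF _ B] iM(2)[OF _ vB]]) auto
  also have "\<dots> \<le> (\<integral>x. \<bar>u x - v x\<bar> \<partial>N)" by (rule integral_abs_bound)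
  also have "\<dots> \<le> (\<integral>x. \<bar>u x + B - c x\<bar> \<partial>N)"
    by (rule integral_mono[OF integrable_abs[OF iM(2)[OF _ uvb]] integrable_abs[OF iM(2)[OF _ cb]] uv]) measurable
  finally have n: "\<bar>(\<integral>x. u x \<partial>N) - (\<integral>x. v x \<partial>N)\<bar> < e / 2" using c by simp
  from m n K[OF v vB] show "\<bar>(\<integral>x. u x \<partial>M) - (\<integral>x. u x \<partial>N)\<bar> \<le> K + e" by linarith
qed

subsection \<open>Gibbs averages and their derivatives\<close>

lemma finite_pairs: "finite (pairs N)"
  by (rule finite_subset[of _ "{..<N} \<times> {..<N}"]) (auto simp: pairs_def)

lemma finite_spins: "finite (spins N)"
proof (rule finite_subset)
  show "spins N \<subseteq> {f. \<forall>x. (x \<in> {..<N} \<longrightarrow> f x \<in> {1, -1}) \<and> (x \<notin> {..<N} \<longrightarrow> f x = 0)}"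
    by (auto simp: spins_def)
qed (rule finite_set_of_finite_funs, auto)

lemma spins_nonempty: "spins N \<noteq> {}"
proof -
  have "(\<lambda>i. if i < N then 1 else 0) \<in> spins N" by (auto simp: spins_def)
  then show ?thesis by blast
qed

lemma spin_abs: "\<sigma> \<in> spins N \<Longrightarrow> k < N \<Longrightarrow> \<bar>\<sigma> k\<bar> = 1"
  by (auto simp: spins_def)

lemma spin_mult_self: "\<sigma> \<in> spins N \<Longrightarrow> k < N \<Longrightarrow> \<sigma> k * \<sigma> k = 1"
  by (auto simp: spins_def)

lemma partition_fn_pos: "0 < partition_fn N \<beta> h g"
  unfolding partition_fn_def by (intro sum_pos finite_spins spins_nonempty) auto

lemma gibbs_nonneg: "0 \<le> gibbs N \<beta> h g \<sigma>"
  using partition_fn_pos[of N \<beta> h g] by (simp add: gibbs_def)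

lemma sum_gibbs: "(\<Sum>\<sigma>\<in>spins N. gibbs N \<beta> h g \<sigma>) = 1"
  using partition_fn_pos[of N \<beta> h g]
  by (simp add: gibbs_def partition_fn_def sum_divide_distrib[symmetric])

lemma gibbs_le_1: "\<sigma> \<in> spins N \<Longrightarrow> gibbs N \<beta> h g \<sigma> \<le> 1"
  using member_le_sum[of \<sigma> "spins N" "gibbs N \<beta> h g"] by (simp add: finite_spins gibbs_nonneg sum_gibbs)

lemma gavg1_cong: "(\<And>\<sigma>. \<sigma> \<in> spins N \<Longrightarrow> F \<sigma> = G \<sigma>) \<Longrightarrow> gavg1 N \<beta> h g F = gavg1 N \<beta> h g G"
  unfolding gavg1_def by (intro sum.cong) auto

lemma gavg1_const [simp]: "gavg1 N \<beta> h g (\<lambda>_. c) = c"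
  by (simp add: gavg1_def sum_distrib_right[symmetric] sum_gibbs)

lemma gavg1_add: "gavg1 N \<beta> h g (\<lambda>\<sigma>. F \<sigma> + G \<sigma>) = gavg1 N \<beta> h g F + gavg1 N \<beta> h g G"
  by (simp add: gavg1_def distrib_left sum.distrib)

lemma gavg1_diff: "gavg1 N \<beta> h g (\<lambda>\<sigma>. F \<sigma> - G \<sigma>) = gavg1 N \<beta> h g F - gavg1 N \<beta> h g G"
  by (simp add: gavg1_def right_diff_distrib sum_subtractf)

lemma gavg1_cmult: "gavg1 N \<beta> h g (\<lambda>\<sigma>. c * F \<sigma>) = c * gavg1 N \<beta> h g F"
  by (simp add: gavg1_def sum_distrib_left mult_ac)

lemma gavg1_mult_const: "gavg1 N \<beta> h g (\<lambda>\<sigma>. F \<sigma> * c) = gavg1 N \<beta> h g F * c"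
  using gavg1_cmult[of N \<beta> h g c F] by (simp add: mult.commute)

lemma gavg1_divide: "gavg1 N \<beta> h g (\<lambda>\<sigma>. F \<sigma> / c) = gavg1 N \<beta> h g F / c"
  using gavg1_mult_const[of N \<beta> h g F "inverse c"] by (simp add: divide_inverse)

lemma gavg1_sum: "gavg1 N \<beta> h g (\<lambda>\<sigma>. \<Sum>t\<in>T. F t \<sigma>) = (\<Sum>t\<in>T. gavg1 N \<beta> h g (F t))"
  by (induction T rule: infinite_finite_induct) (auto simp: gavg1_add)

lemmas gavg1_linear = gavg1_add gavg1_diff gavg1_cmult gavg1_mult_const gavg1_divide gavg1_sum

lemma gavg1_mono:
  "(\<And>\<sigma>. \<sigma> \<in> spins N \<Longrightarrow> F \<sigma> \<le> G \<sigma>) \<Longrightarrow> gavg1 N \<beta> h g F \<le> gavg1 N \<beta> h g G"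
  unfolding gavg1_def by (intro sum_mono mult_left_mono gibbs_nonneg)

lemma gavg1_nonneg: "(\<And>\<sigma>. \<sigma> \<in> spins N \<Longrightarrow> 0 \<le> F \<sigma>) \<Longrightarrow> 0 \<le> gavg1 N \<beta> h g F"
  unfolding gavg1_def by (intro sum_nonneg mult_nonneg_nonneg gibbs_nonneg)

lemma gavg1_abs: "\<bar>gavg1 N \<beta> h g F\<bar> \<le> gavg1 N \<beta> h g (\<lambda>\<sigma>. \<bar>F \<sigma>\<bar>)"
  unfolding gavg1_def
  by (rule order_trans[OF sum_abs]) (simp add: abs_mult gibbs_nonneg)

text \<open>Giving each factor the square root of the Gibbs weight reduces this to the inequality
  for finite sums.\<close>

lemma gavg1_cauchy_schwarz:
  "gavg1 N \<beta> h g (\<lambda>\<sigma>. \<bar>F \<sigma>\<bar> * \<bar>G \<sigma>\<bar>)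
    \<le> sqrt (gavg1 N \<beta> h g (\<lambda>\<sigma>. (F \<sigma>)\<^sup>2)) * sqrt (gavg1 N \<beta> h g (\<lambda>\<sigma>. (G \<sigma>)\<^sup>2))"
proof -
  let ?w = "\<lambda>\<sigma>. sqrt (gibbs N \<beta> h g \<sigma>)"
  have w: "?w \<sigma> * ?w \<sigma> = gibbs N \<beta> h g \<sigma>" for \<sigma> by (simp add: gibbs_nonneg)
  have sq: "(?w \<sigma> * F \<sigma>)\<^sup>2 = gibbs N \<beta> h g \<sigma> * (F \<sigma>)\<^sup>2" for F \<sigma>
    by (simp add: power_mult_distrib gibbs_nonneg)
  have "gavg1 N \<beta> h g (\<lambda>\<sigma>. \<bar>F \<sigma>\<bar> * \<bar>G \<sigma>\<bar>) = (\<Sum>\<sigma>\<in>spins N. \<bar>?w \<sigma> * F \<sigma>\<bar> * \<bar>?w \<sigma> * G \<sigma>\<bar>)"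
    unfolding gavg1_def
  proof (intro sum.cong refl)
    fix \<sigma>
    have "\<bar>?w \<sigma> * F \<sigma>\<bar> * \<bar>?w \<sigma> * G \<sigma>\<bar> = (?w \<sigma> * ?w \<sigma>) * (\<bar>F \<sigma>\<bar> * \<bar>G \<sigma>\<bar>)"
      by (simp only: abs_mult abs_of_nonneg[OF real_sqrt_ge_zero[OF gibbs_nonneg]] mult_ac)
    then show "gibbs N \<beta> h g \<sigma> * (\<bar>F \<sigma>\<bar> * \<bar>G \<sigma>\<bar>) = \<bar>?w \<sigma> * F \<sigma>\<bar> * \<bar>?w \<sigma> * G \<sigma>\<bar>" unfolding w by simp
  qed
  also have "\<dots> \<le> L2_set (\<lambda>\<sigma>. ?w \<sigma> * F \<sigma>) (spins N) * L2_set (\<lambda>\<sigma>. ?w \<sigma> * G \<sigma>) (spins N)"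
    by (rule L2_set_mult_ineq)
  finally show ?thesis by (simp add: L2_set_def sq gavg1_def)
qed

lemma gavg1_abs_le_sqrt: "gavg1 N \<beta> h g (\<lambda>\<sigma>. \<bar>F \<sigma>\<bar>) \<le> sqrt (gavg1 N \<beta> h g (\<lambda>\<sigma>. (F \<sigma>)\<^sup>2))"
  using gavg1_cauchy_schwarz[of N \<beta> h g F "\<lambda>_. 1"] by simp

lemma gavg1_square_le: "(gavg1 N \<beta> h g F)\<^sup>2 \<le> gavg1 N \<beta> h g (\<lambda>\<sigma>. (F \<sigma>)\<^sup>2)"
proof -
  have nn: "0 \<le> gavg1 N \<beta> h g (\<lambda>\<sigma>. (F \<sigma>)\<^sup>2)" by (intro gavg1_nonneg) simp
  have "\<bar>gavg1 N \<beta> h g F\<bar> \<le> sqrt (gavg1 N \<beta> h g (\<lambda>\<sigma>. (F \<sigma>)\<^sup>2))"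
    by (rule order_trans[OF gavg1_abs gavg1_abs_le_sqrt])
  from power_mono[OF this abs_ge_zero, of 2] nn show ?thesis by simp
qed

text \<open>Here \<open>l\<close> will be the local field, which is controlled only through its
  second moment, and \<open>G\<close> an overlap error that is small only in mean square.
  Cauchy-Schwarz under the Gibbs measure is therefore the way to multiply them.\<close>

lemma gavg1_mult_bound:
  assumes F: "\<And>\<sigma>. \<sigma> \<in> spins N \<Longrightarrow> \<bar>F \<sigma>\<bar> \<le> a * \<bar>l \<sigma>\<bar> + c" and "0 \<le> a" "0 \<le> c"
  shows "\<bar>gavg1 N \<beta> h g (\<lambda>\<sigma>. F \<sigma> * G \<sigma>)\<bar>
    \<le> (a * sqrt (gavg1 N \<beta> h g (\<lambda>\<sigma>. (l \<sigma>)\<^sup>2)) + c) * sqrt (gavg1 N \<beta> h g (\<lambda>\<sigma>. (G \<sigma>)\<^sup>2))"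
proof -
  let ?av = "gavg1 N \<beta> h g"
  have "\<bar>?av (\<lambda>\<sigma>. F \<sigma> * G \<sigma>)\<bar> \<le> ?av (\<lambda>\<sigma>. \<bar>F \<sigma> * G \<sigma>\<bar>)" by (rule gavg1_abs)
  also have "\<dots> \<le> ?av (\<lambda>\<sigma>. a * (\<bar>l \<sigma>\<bar> * \<bar>G \<sigma>\<bar>) + c * \<bar>G \<sigma>\<bar>)"
  proof (intro gavg1_mono)
    fix \<sigma> assume "\<sigma> \<in> spins N"
    from mult_right_mono[OF F[OF this] abs_ge_zero[of "G \<sigma>"]]
    show "\<bar>F \<sigma> * G \<sigma>\<bar> \<le> a * (\<bar>l \<sigma>\<bar> * \<bar>G \<sigma>\<bar>) + c * \<bar>G \<sigma>\<bar>"
      by (simp add: abs_mult distrib_right mult.assoc)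
  qed
  also have "\<dots> = a * ?av (\<lambda>\<sigma>. \<bar>l \<sigma>\<bar> * \<bar>G \<sigma>\<bar>) + c * ?av (\<lambda>\<sigma>. \<bar>G \<sigma>\<bar>)"
    by (simp add: gavg1_linear)
  also have "\<dots> \<le> a * (sqrt (?av (\<lambda>\<sigma>. (l \<sigma>)\<^sup>2)) * sqrt (?av (\<lambda>\<sigma>. (G \<sigma>)\<^sup>2))) + c * sqrt (?av (\<lambda>\<sigma>. (G \<sigma>)\<^sup>2))"
    using assms(2,3) by (intro add_mono mult_left_mono gavg1_cauchy_schwarz gavg1_abs_le_sqrt)
  finally show ?thesis by (simp add: algebra_simps)
qed

lemma gavg2_eq: "gavg2 N \<beta> h g F = gavg1 N \<beta> h g (\<lambda>\<sigma>. gavg1 N \<beta> h g (F \<sigma>))"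
  by (simp add: gavg2_def gavg1_def sum_distrib_left mult.assoc)

lemma hamil_partial:
  assumes p: "(a, b) \<in> pairs N"
  shows "((\<lambda>y. hamil N \<beta> h (g((a,b) := y)) \<sigma>) has_real_derivative \<beta> / sqrt (real N) * (\<sigma> a * \<sigma> b)) (at z)"
proof -
  have "(\<Sum>p\<in>pairs N. (g((a,b) := y)) p * \<sigma> (fst p) * \<sigma> (snd p))
      = y * (\<sigma> a * \<sigma> b) + (\<Sum>p\<in>pairs N - {(a,b)}. g p * \<sigma> (fst p) * \<sigma> (snd p))" for y
    by (subst sum.remove[OF finite_pairs p]) (auto intro!: sum.cong)
  moreover have "((\<lambda>y. e * (y * c + S) + r) has_real_derivative e * c) (at z)" for e c S r :: real
    by (auto intro!: derivative_eq_intros)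
  ultimately show ?thesis by (simp only: hamil_def)
qed

lemma tame_hamil: "tame (pairs N) (\<lambda>g. hamil N \<beta> h g \<sigma>)"
  unfolding hamil_def by (intro tame_intros tame_coord finite_pairs)

lemma gibbs_measurable: "(\<lambda>g. gibbs N \<beta> h g \<sigma>) \<in> borel_measurable (gaussian_vector (pairs N))"
proof -
  have [measurable]: "(\<lambda>g. hamil N \<beta> h g \<tau>) \<in> borel_measurable (gaussian_vector (pairs N))" for \<tau>
    by (rule tame_measurable[OF tame_hamil])
  show ?thesis unfolding gibbs_def partition_fn_def by measurable
qed

lemma tame_gibbs: "\<sigma> \<in> spins N \<Longrightarrow> tame (pairs N) (\<lambda>g. gibbs N \<beta> h g \<sigma>)"
  by (rule tame_bounded[where B=1]) (auto simp: gibbs_measurable gibbs_nonneg gibbs_le_1)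

lemma tame_gavg1:
  assumes "\<And>\<sigma>. \<sigma> \<in> spins N \<Longrightarrow> tame (pairs N) (\<lambda>g. F g \<sigma>)"
  shows "tame (pairs N) (\<lambda>g. gavg1 N \<beta> h g (F g))"
  unfolding gavg1_def by (intro tame_intros tame_gibbs assms)

text \<open>The logarithmic derivative of a Gibbs weight is the derivative of the Hamiltonian minus
  its Gibbs average. Tameness is immediate, as the weight lies between 0 and 1.\<close>

lemma partial_at_gibbs:
  assumes p: "(a, b) \<in> pairs N" and \<sigma>: "\<sigma> \<in> spins N"
  shows "partial_at (pairs N) (a, b) (\<lambda>g. gibbs N \<beta> h g \<sigma>)
    (\<lambda>g. \<beta> / sqrt (real N) * (gibbs N \<beta> h g \<sigma> * (\<sigma> a * \<sigma> b - gavg1 N \<beta> h g (\<lambda>\<tau>. \<tau> a * \<tau> b))))"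
  unfolding partial_at_def
proof (intro conjI allI)
  show "tame (pairs N) (\<lambda>g. gibbs N \<beta> h g \<sigma>)" by (rule tame_gibbs[OF \<sigma>])
  show "tame (pairs N) (\<lambda>g. \<beta> / sqrt (real N) * (gibbs N \<beta> h g \<sigma> * (\<sigma> a * \<sigma> b - gavg1 N \<beta> h g (\<lambda>\<tau>. \<tau> a * \<tau> b))))"
    by (intro tame_intros tame_gibbs[OF \<sigma>] tame_gavg1)
next
  fix g :: "nat \<times> nat \<Rightarrow> real"
  let ?H = "\<lambda>y. hamil N \<beta> h (g((a,b) := y))" and ?Z = "\<lambda>y. partition_fn N \<beta> h (g((a,b) := y))"
  let ?e = "\<beta> / sqrt (real N)" and ?z = "g (a,b)"
  have upd: "g((a,b) := ?z) = g" by simp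
  have dE: "((\<lambda>y. exp (?H y \<tau>)) has_real_derivative exp (hamil N \<beta> h g \<tau>) * (?e * (\<tau> a * \<tau> b))) (at ?z)" for \<tau>
    using DERIV_chain2[OF DERIV_exp hamil_partial[OF p, where \<beta>=\<beta> and h=h and g=g and \<sigma>=\<tau> and z="?z"]]
    by (simp only: upd)
  have dZ: "(?Z has_real_derivative (\<Sum>\<tau>\<in>spins N. exp (hamil N \<beta> h g \<tau>) * (?e * (\<tau> a * \<tau> b)))) (at ?z)"
    unfolding partition_fn_def by (intro DERIV_sum dE)
  have Z: "0 < partition_fn N \<beta> h g" by (rule partition_fn_pos)
  have Z': "(\<Sum>\<tau>\<in>spins N. exp (hamil N \<beta> h g \<tau>) * (?e * (\<tau> a * \<tau> b)))
      = ?e * (partition_fn N \<beta> h g * gavg1 N \<beta> h g (\<lambda>\<tau>. \<tau> a * \<tau> b))"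
    using Z by (simp add: gavg1_def gibbs_def sum_distrib_left mult_ac)
  have "((\<lambda>y. exp (?H y \<sigma>) / ?Z y) has_real_derivative
      (exp (hamil N \<beta> h g \<sigma>) * (?e * (\<sigma> a * \<sigma> b)) * partition_fn N \<beta> h g
        - exp (hamil N \<beta> h g \<sigma>) * (?e * (partition_fn N \<beta> h g * gavg1 N \<beta> h g (\<lambda>\<tau>. \<tau> a * \<tau> b))))
      / (partition_fn N \<beta> h g * partition_fn N \<beta> h g)) (at ?z)"
    using DERIV_divide[OF dE dZ] Z unfolding Z' by (simp add: upd)
  moreover have "(exp (hamil N \<beta> h g \<sigma>) * (?e * (\<sigma> a * \<sigma> b)) * partition_fn N \<beta> h g
        - exp (hamil N \<beta> h g \<sigma>) * (?e * (partition_fn N \<beta> h g * gavg1 N \<beta> h g (\<lambda>\<tau>. \<tau> a * \<tau> b))))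
      / (partition_fn N \<beta> h g * partition_fn N \<beta> h g)
      = ?e * (gibbs N \<beta> h g \<sigma> * (\<sigma> a * \<sigma> b - gavg1 N \<beta> h g (\<lambda>\<tau>. \<tau> a * \<tau> b)))"
  proof -
    have "(x * (e * s) * z - x * (e * (z * t))) / (z * z) = e * (x / z * (s - t))" if "0 < z" for x e s z t :: real
      using that by (simp add: field_simps)
    then show ?thesis using Z unfolding gibbs_def .
  qed
  ultimately show "((\<lambda>y. gibbs N \<beta> h (g((a,b) := y)) \<sigma>) has_real_derivative
      ?e * (gibbs N \<beta> h g \<sigma> * (\<sigma> a * \<sigma> b - gavg1 N \<beta> h g (\<lambda>\<tau>. \<tau> a * \<tau> b)))) (at ?z)"
    unfolding gibbs_def by simp
qed

text \<open>Besides the explicit derivative, the average responds to a coupling through its Gibbs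
  covariance with the product of the two coupled spins.\<close>

lemma partial_at_gavg1:
  assumes p: "(a, b) \<in> pairs N"
    and F: "\<And>\<sigma>. \<sigma> \<in> spins N \<Longrightarrow> partial_at (pairs N) (a, b) (\<lambda>g. F g \<sigma>) (\<lambda>g. F' g \<sigma>)"
  shows "partial_at (pairs N) (a, b) (\<lambda>g. gavg1 N \<beta> h g (F g))
    (\<lambda>g. gavg1 N \<beta> h g (F' g) + \<beta> / sqrt (real N) *
      (gavg1 N \<beta> h g (\<lambda>\<sigma>. F g \<sigma> * (\<sigma> a * \<sigma> b)) - gavg1 N \<beta> h g (F g) * gavg1 N \<beta> h g (\<lambda>\<sigma>. \<sigma> a * \<sigma> b)))"
proof (rule partial_at_cong)
  show "partial_at (pairs N) (a, b) (\<lambda>g. gavg1 N \<beta> h g (F g))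
    (\<lambda>g. \<Sum>\<sigma>\<in>spins N. \<beta> / sqrt (real N) * (gibbs N \<beta> h g \<sigma> * (\<sigma> a * \<sigma> b - gavg1 N \<beta> h g (\<lambda>\<tau>. \<tau> a * \<tau> b))) * F g \<sigma>
        + gibbs N \<beta> h g \<sigma> * F' g \<sigma>)"
    unfolding gavg1_def[of _ _ _ _ "F _"]
    by (intro partial_at_sum partial_at_mult partial_at_gibbs p F)
next
  fix g
  let ?s = "gavg1 N \<beta> h g (\<lambda>\<tau>. \<tau> a * \<tau> b)" and ?e = "\<beta> / sqrt (real N)"
  have "(\<Sum>\<sigma>\<in>spins N. ?e * (gibbs N \<beta> h g \<sigma> * (\<sigma> a * \<sigma> b - ?s)) * F g \<sigma> + gibbs N \<beta> h g \<sigma> * F' g \<sigma>)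
      = gavg1 N \<beta> h g (\<lambda>\<sigma>. ?e * (F g \<sigma> * (\<sigma> a * \<sigma> b) - F g \<sigma> * ?s) + F' g \<sigma>)"
    unfolding gavg1_def[of N \<beta> h g "\<lambda>\<sigma>. ?e * (F g \<sigma> * (\<sigma> a * \<sigma> b) - F g \<sigma> * ?s) + F' g \<sigma>"]
    by (intro sum.cong refl) (simp add: algebra_simps)
  then show "(\<Sum>\<sigma>\<in>spins N. ?e * (gibbs N \<beta> h g \<sigma> * (\<sigma> a * \<sigma> b - ?s)) * F g \<sigma> + gibbs N \<beta> h g \<sigma> * F' g \<sigma>)
      = gavg1 N \<beta> h g (F' g) + ?e * (gavg1 N \<beta> h g (\<lambda>\<sigma>. F g \<sigma> * (\<sigma> a * \<sigma> b)) - gavg1 N \<beta> h g (F g) * ?s)"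
    by (simp only: gavg1_add gavg1_diff gavg1_cmult gavg1_mult_const add.commute)
qed

subsection \<open>The local field at a site\<close>

locale cavity =
  fixes N i :: nat and \<beta> h q :: real
  assumes site: "i < N" and beta_pos: "0 < \<beta>" and q_pos: "0 < q" and q_less: "q < 1"
begin

abbreviation av :: "(nat \<times> nat \<Rightarrow> real) \<Rightarrow> ((nat \<Rightarrow> real) \<Rightarrow> real) \<Rightarrow> real" where
  "av \<equiv> gavg1 N \<beta> h"

abbreviation EE :: "((nat \<times> nat \<Rightarrow> real) \<Rightarrow> real) \<Rightarrow> real" where
  "EE F \<equiv> (\<integral>g. F g \<partial>gaussian_vector (pairs N))"

text \<open>Here \<open>loc\<close> is the local field at site \<open>i\<close> and \<open>ov\<close> the overlap with that site left out. All errors are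
  measured by \<open>\<kappa>\<close>, whose second summand makes \<open>sqrt \<kappa>\<close> dominate \<open>1 / N\<close> too. The quantity \<open>defect\<close>
  is the Gibbs covariance of the local field and the spin minus its limiting value.\<close>

definition J :: "nat set" where "J = {..<N} - {i}"
definition \<epsilon> :: real where "\<epsilon> = 1 / sqrt (real N)"
definition edge :: "nat \<Rightarrow> nat \<times> nat" where "edge k = (min i k, max i k)"
definition loc :: "(nat \<times> nat \<Rightarrow> real) \<Rightarrow> (nat \<Rightarrow> real) \<Rightarrow> real" where
  "loc g \<sigma> = \<epsilon> * (\<Sum>k\<in>J. gs g i k * \<sigma> k)"
definition ov :: "(nat \<Rightarrow> real) \<Rightarrow> (nat \<Rightarrow> real) \<Rightarrow> real" where
  "ov \<sigma> \<tau> = (\<Sum>k\<in>J. \<sigma> k * \<tau> k) / real N"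
definition b :: real where "b = \<beta> * (1 - q)"
definition mag :: "(nat \<times> nat \<Rightarrow> real) \<Rightarrow> nat \<Rightarrow> real" where "mag g k = av g (\<lambda>\<sigma>. \<sigma> k)"
definition cor :: "(nat \<times> nat \<Rightarrow> real) \<Rightarrow> nat \<Rightarrow> real" where "cor g k = av g (\<lambda>\<sigma>. \<sigma> i * \<sigma> k)"
definition loc0 :: "(nat \<times> nat \<Rightarrow> real) \<Rightarrow> real" where "loc0 g = av g (loc g)"
definition loc1 :: "(nat \<times> nat \<Rightarrow> real) \<Rightarrow> nat \<Rightarrow> real" where "loc1 g k = av g (\<lambda>\<sigma>. loc g \<sigma> * \<sigma> k)"
definition loc2 :: "(nat \<times> nat \<Rightarrow> real) \<Rightarrow> real" where "loc2 g = av g (\<lambda>\<sigma>. (loc g \<sigma>)\<^sup>2)"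
definition \<kappa> :: "(nat \<times> nat \<Rightarrow> real) \<Rightarrow> real" where
  "\<kappa> g = av g (\<lambda>\<sigma>. av g (\<lambda>\<tau>. (ov \<sigma> \<tau> - q)\<^sup>2)) + 1 / real N"
text \<open>This is \<open>ov - q\<close> with one replica averaged out. Sums over \<open>k\<close>
  with weights \<open>mag g k\<close> turn into \<open>dev\<close> plus \<open>q\<close>, which is
  how \<open>q\<close> takes the place of the overlap.\<close>

definition dev :: "(nat \<times> nat \<Rightarrow> real) \<Rightarrow> (nat \<Rightarrow> real) \<Rightarrow> real" where
  "dev g \<tau> = (\<Sum>k\<in>J. mag g k * \<tau> k) / real N - q"
definition cov :: "(nat \<times> nat \<Rightarrow> real) \<Rightarrow> nat \<Rightarrow> real" where "cov g k = cor g k - mag g k * mag g i"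
text \<open>This is the Gibbs covariance, over a second replica, of the spin at \<open>i\<close>
  with \<open>ov\<close>; it collects the sums over \<open>k\<close> with weights
  \<open>cov g k\<close>.\<close>

definition rho :: "(nat \<times> nat \<Rightarrow> real) \<Rightarrow> (nat \<Rightarrow> real) \<Rightarrow> real" where
  "rho g \<tau> = (\<Sum>k\<in>J. cov g k * \<tau> k) / real N"
definition covsq :: "(nat \<times> nat \<Rightarrow> real) \<Rightarrow> real" where "covsq g = (\<Sum>k\<in>J. cov g k * cov g k) / real N"
definition magsq :: "(nat \<times> nat \<Rightarrow> real) \<Rightarrow> real" where "magsq g = (\<Sum>k\<in>J. mag g k * mag g k) / real N"
definition defect :: "(nat \<times> nat \<Rightarrow> real) \<Rightarrow> real" where
  "defect g = loc1 g i - loc0 g * mag g i - b * (1 - (mag g i)\<^sup>2)"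
definition cav :: "(nat \<times> nat \<Rightarrow> real) \<Rightarrow> real" where "cav g = loc0 g - b * mag g i"

lemma N_pos: "0 < real N" using site by simp

lemma eps_sq: "\<epsilon> * \<epsilon> = 1 / real N"
  using N_pos by (simp add: \<epsilon>_def)

lemma eps_pos: "0 < \<epsilon>" using N_pos by (simp add: \<epsilon>_def)

lemma J_less: "k \<in> J \<Longrightarrow> k < N" by (simp add: J_def)

text \<open>Cavity sums have \<open>N - 1\<close> terms but are normalized by \<open>N\<close>. The
  deficit \<open>1 / N\<close> becomes one of the errors dominated by
  \<open>sqrt (\<kappa> g)\<close>.\<close>

lemma card_J: "real (card J) / real N = 1 - 1 / real N"
  using site by (simp add: J_def field_simps of_nat_diff)

lemma edge_in_pairs: "k \<in> J \<Longrightarrow> edge k \<in> pairs N"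
  using site by (auto simp: J_def edge_def pairs_def min_def max_def)

lemma edge_inj: "edge j = edge k \<longleftrightarrow> j = k"
  by (auto simp: edge_def min_def max_def split: if_splits)

lemma gs_eq: "k \<in> J \<Longrightarrow> gs g i k = g (edge k)"
  by (auto simp: gs_def edge_def J_def)

lemma edge_mult: "\<sigma> (min i k) * \<sigma> (max i k) = \<sigma> i * \<sigma> k" for \<sigma> :: "nat \<Rightarrow> real"
  by (cases "i \<le> k") (auto simp: min_def max_def)

lemma cav_eq: "cav_r N \<beta> h q g i = cav g"
  by (simp add: cav_r_def cav_def loc0_def loc_def[abs_def] b_def mag_def \<epsilon>_def J_def gavg1_linear)

lemma tame_gs: "k \<in> J \<Longrightarrow> tame (pairs N) (\<lambda>g. gs g i k)"
  by (simp add: gs_eq tame_coord finite_pairs edge_in_pairs)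

lemma tame_loc: "tame (pairs N) (\<lambda>g. loc g \<sigma>)"
  unfolding loc_def by (intro tame_intros tame_gs)

lemmas tame_cav_intros = tame_intros tame_gavg1 tame_loc tame_gs

lemma tame_defs:
  "tame (pairs N) (\<lambda>g. mag g k)" "tame (pairs N) (\<lambda>g. cor g k)" "tame (pairs N) loc0"
  "tame (pairs N) (\<lambda>g. loc1 g k)" "tame (pairs N) loc2" "tame (pairs N) \<kappa>"
proof -
  show "tame (pairs N) (\<lambda>g. mag g k)" unfolding mag_def by (intro tame_cav_intros)
  show "tame (pairs N) (\<lambda>g. cor g k)" unfolding cor_def by (intro tame_cav_intros)
  show "tame (pairs N) loc0" unfolding loc0_def[abs_def] by (intro tame_cav_intros)
  show "tame (pairs N) (\<lambda>g. loc1 g k)" unfolding loc1_def by (intro tame_cav_intros)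
  show "tame (pairs N) loc2" unfolding loc2_def[abs_def] by (intro tame_cav_intros)
  show "tame (pairs N) \<kappa>" unfolding \<kappa>_def[abs_def] by (intro tame_cav_intros)
qed

lemma tame_defect: "tame (pairs N) defect"
  unfolding defect_def[abs_def] by (intro tame_intros tame_defs)

lemma tame_cav: "tame (pairs N) cav"
  unfolding cav_def[abs_def] by (intro tame_intros tame_defs)

section \<open>Derivatives along the couplings of the site\<close>

lemma partial_loc:
  assumes k: "k \<in> J"
  shows "partial_at (pairs N) (edge k) (\<lambda>g. loc g \<sigma>) (\<lambda>_. \<epsilon> * \<sigma> k)"
proof -
  have fin: "finite J" by (simp add: J_def)
  have eq: "(\<lambda>g. loc g \<sigma>) = (\<lambda>g. \<epsilon> * (\<Sum>j\<in>J. g (edge j) * \<sigma> j))"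
    by (rule ext) (simp add: loc_def gs_eq cong: sum.cong)
  show ?thesis
    unfolding eq
  proof (rule partial_at_cong)
    show "partial_at (pairs N) (edge k) (\<lambda>g. \<epsilon> * (\<Sum>j\<in>J. g (edge j) * \<sigma> j))
      (\<lambda>g. 0 * (\<Sum>j\<in>J. g (edge j) * \<sigma> j)
        + \<epsilon> * (\<Sum>j\<in>J. (if edge j = edge k then 1 else 0) * \<sigma> j + g (edge j) * 0))"
      by (intro partial_at_mult partial_at_sum partial_at_coord partial_at_const finite_pairs edge_in_pairs)
    have "(if edge j = edge k then 1 else 0) * \<sigma> j = (if j = k then \<sigma> j else 0)" for j
      by (simp add: edge_inj)
    then show "0 * (\<Sum>j\<in>J. g (edge j) * \<sigma> j)
        + \<epsilon> * (\<Sum>j\<in>J. (if edge j = edge k then 1 else 0) * \<sigma> j + g (edge j) * 0) = \<epsilon> * \<sigma> k" for g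
      using k fin by simp
  qed
qed

lemma partial_av:
  assumes k: "k \<in> J"
    and F: "\<And>\<sigma>. \<sigma> \<in> spins N \<Longrightarrow> partial_at (pairs N) (edge k) (\<lambda>g. F g \<sigma>) (\<lambda>g. F' g \<sigma>)"
  shows "partial_at (pairs N) (edge k) (\<lambda>g. av g (F g))
    (\<lambda>g. av g (F' g) + \<epsilon> * \<beta> * (av g (\<lambda>\<sigma>. F g \<sigma> * (\<sigma> i * \<sigma> k)) - av g (F g) * cor g k))"
  using partial_at_gavg1[OF edge_in_pairs[OF k, unfolded edge_def] F[unfolded edge_def], where \<beta>=\<beta> and h=h]
  unfolding edge_mult cor_def by (simp add: edge_def \<epsilon>_def)

lemma partial_av_const:
  "k \<in> J \<Longrightarrow> partial_at (pairs N) (edge k) (\<lambda>g. av g F)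
    (\<lambda>g. \<epsilon> * \<beta> * (av g (\<lambda>\<sigma>. F \<sigma> * (\<sigma> i * \<sigma> k)) - av g F * cor g k))"
  using partial_av[of k "\<lambda>_. F" "\<lambda>_ _. 0"] by (simp add: partial_at_const)

lemma partial_av_loc:
  assumes k: "k \<in> J"
  shows "partial_at (pairs N) (edge k) (\<lambda>g. av g (\<lambda>\<sigma>. loc g \<sigma> * F \<sigma>))
    (\<lambda>g. \<epsilon> * av g (\<lambda>\<sigma>. \<sigma> k * F \<sigma>)
      + \<epsilon> * \<beta> * (av g (\<lambda>\<sigma>. loc g \<sigma> * F \<sigma> * (\<sigma> i * \<sigma> k)) - av g (\<lambda>\<sigma>. loc g \<sigma> * F \<sigma>) * cor g k))"
proof (rule partial_at_cong[OF partial_av[OF k, where F="\<lambda>g \<sigma>. loc g \<sigma> * F \<sigma>"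
        and F'="\<lambda>g \<sigma>. \<epsilon> * \<sigma> k * F \<sigma> + loc g \<sigma> * 0"]])
  show "partial_at (pairs N) (edge k) (\<lambda>g. loc g \<sigma> * F \<sigma>) (\<lambda>g. \<epsilon> * \<sigma> k * F \<sigma> + loc g \<sigma> * 0)" for \<sigma>
    by (intro partial_at_mult partial_loc partial_at_const k)
qed (simp add: mult.assoc gavg1_cmult)

text \<open>Only couplings at \<open>i\<close> are differentiated, so every response is against
  \<open>\<sigma> i * \<sigma> k\<close>. As spins square to one, this product merely exchanges the
  spins at \<open>i\<close> and \<open>k\<close>, and differentiation closes on a short list of
  averages.\<close>

lemma spin_simps:
  assumes "\<sigma> \<in> spins N" "k \<in> J"
  shows "\<sigma> i * (\<sigma> i * \<sigma> k) = \<sigma> k" "\<sigma> k * (\<sigma> i * \<sigma> k) = \<sigma> i" "\<sigma> i * \<sigma> k * (\<sigma> i * \<sigma> k) = 1"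
    "\<sigma> k * \<sigma> k = 1"
  using spin_mult_self[OF assms(1) site] spin_mult_self[OF assms(1) J_less[OF assms(2)]]
  by (simp_all add: mult.assoc mult.left_commute)

lemma partial_mag_site:
  assumes "k \<in> J"
  shows "partial_at (pairs N) (edge k) (\<lambda>g. mag g i) (\<lambda>g. \<epsilon> * \<beta> * (mag g k - mag g i * cor g k))"
  unfolding mag_def
  by (rule partial_at_cong[OF partial_av_const[OF assms]])
    (simp add: spin_simps(1) assms cong: gavg1_cong)

lemma partial_mag:
  assumes "k \<in> J"
  shows "partial_at (pairs N) (edge k) (\<lambda>g. mag g k) (\<lambda>g. \<epsilon> * \<beta> * (mag g i - mag g k * cor g k))"
  unfolding mag_def
  by (rule partial_at_cong[OF partial_av_const[OF assms]])
    (simp add: spin_simps(2) assms cong: gavg1_cong)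

lemma partial_cor:
  assumes "k \<in> J"
  shows "partial_at (pairs N) (edge k) (\<lambda>g. cor g k) (\<lambda>g. \<epsilon> * \<beta> * (1 - cor g k * cor g k))"
  unfolding cor_def
  by (rule partial_at_cong[OF partial_av_const[OF assms]])
    (simp add: spin_simps(3) assms cor_def cong: gavg1_cong)

lemma partial_loc0:
  assumes "k \<in> J"
  shows "partial_at (pairs N) (edge k) loc0
    (\<lambda>g. \<epsilon> * mag g k + \<epsilon> * \<beta> * (av g (\<lambda>\<sigma>. loc g \<sigma> * (\<sigma> i * \<sigma> k)) - loc0 g * cor g k))"
  using partial_av_loc[OF assms, of "\<lambda>_. 1"] by (simp add: loc0_def[abs_def] mag_def)

lemma partial_loc1_site:
  assumes "k \<in> J"
  shows "partial_at (pairs N) (edge k) (\<lambda>g. loc1 g i)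
    (\<lambda>g. \<epsilon> * cor g k + \<epsilon> * \<beta> * (loc1 g k - loc1 g i * cor g k))"
  unfolding loc1_def
  by (rule partial_at_cong[OF partial_av_loc[OF assms]])
    (simp add: spin_simps(1) assms cor_def mult.assoc mult.commute[of "_ k" "_ i"] cong: gavg1_cong)

lemma partial_loc1:
  assumes "k \<in> J"
  shows "partial_at (pairs N) (edge k) (\<lambda>g. loc1 g k)
    (\<lambda>g. \<epsilon> + \<epsilon> * \<beta> * (loc1 g i - loc1 g k * cor g k))"
  unfolding loc1_def
  by (rule partial_at_cong[OF partial_av_loc[OF assms]])
    (simp add: spin_simps(2,4) assms mult.assoc cong: gavg1_cong)

text \<open>In the average over \<open>k\<close> the product term tends to
  \<open>(1 - q) * (1 - (mag g i)\<^sup>2)\<close> while the squares give the small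
  \<open>covsq\<close>. This produces the limiting value subtracted in
  \<open>defect\<close>.\<close>

lemma partial_cov:
  assumes k: "k \<in> J"
  shows "partial_at (pairs N) (edge k) (\<lambda>g. cov g k)
    (\<lambda>g. \<epsilon> * \<beta> * ((1 - (mag g i)\<^sup>2) * (1 - mag g k * mag g k) - cov g k * cov g k))"
  unfolding cov_def
  by (rule partial_at_cong[OF partial_at_diff[OF partial_cor[OF k] partial_at_mult[OF partial_mag[OF k] partial_mag_site[OF k]]]])
    (simp add: algebra_simps power2_eq_square)

text \<open>Up to \<open>\<epsilon> * cov g k\<close>, the derivative of \<open>defect\<close> in direction \<open>k\<close> is \<open>\<epsilon> * \<beta>\<close> times the
  average of \<open>tilt g\<close> against the spin at \<open>k\<close>; \<open>field\<close> plays the same role for \<open>cav\<close>.\<close>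

definition tilt :: "(nat \<times> nat \<Rightarrow> real) \<Rightarrow> (nat \<Rightarrow> real) \<Rightarrow> real" where
  "tilt g \<sigma> = loc g \<sigma> - loc1 g i * \<sigma> i - mag g i * (loc g \<sigma> * \<sigma> i) + 2 * loc0 g * mag g i * \<sigma> i - loc0 g
     + 2 * b * mag g i * (1 - mag g i * \<sigma> i)"

lemma av_tilt:
  "av g (\<lambda>\<sigma>. tilt g \<sigma> * \<sigma> k) = loc1 g k - loc1 g i * cor g k - mag g i * av g (\<lambda>\<sigma>. loc g \<sigma> * (\<sigma> i * \<sigma> k))
     + 2 * loc0 g * mag g i * cor g k - loc0 g * mag g k + 2 * b * mag g i * (mag g k - mag g i * cor g k)"
proof -
  have "av g (\<lambda>\<sigma>. tilt g \<sigma> * \<sigma> k) = av g (\<lambda>\<sigma>. loc g \<sigma> * \<sigma> k - loc1 g i * (\<sigma> i * \<sigma> k)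
      - mag g i * (loc g \<sigma> * (\<sigma> i * \<sigma> k)) + (2 * loc0 g * mag g i) * (\<sigma> i * \<sigma> k) - loc0 g * \<sigma> k
      + (2 * b * mag g i) * (\<sigma> k - mag g i * (\<sigma> i * \<sigma> k)))"
    by (rule gavg1_cong) (simp add: tilt_def algebra_simps)
  then show ?thesis
    by (simp only: gavg1_add gavg1_diff gavg1_cmult loc1_def cor_def mag_def)
qed

lemma partial_defect:
  assumes k: "k \<in> J"
  shows "partial_at (pairs N) (edge k) defect (\<lambda>g. \<epsilon> * cov g k + \<epsilon> * \<beta> * av g (\<lambda>\<sigma>. tilt g \<sigma> * \<sigma> k))"
proof -
  have eq: "defect = (\<lambda>g. loc1 g i - loc0 g * mag g i - b * (1 - mag g i * mag g i))"
    by (simp add: fun_eq_iff defect_def power2_eq_square)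
  show ?thesis
    unfolding eq
    by (rule partial_at_cong[OF partial_at_diff[OF partial_at_diff[OF partial_loc1_site[OF k]
            partial_at_mult[OF partial_loc0[OF k] partial_mag_site[OF k]]]
            partial_at_mult[OF partial_at_const partial_at_diff[OF partial_at_const
              partial_at_mult[OF partial_mag_site[OF k] partial_mag_site[OF k]]]]]])
      (simp only: av_tilt cov_def, simp add: algebra_simps)
qed

definition field :: "(nat \<times> nat \<Rightarrow> real) \<Rightarrow> (nat \<Rightarrow> real) \<Rightarrow> real" where
  "field g \<sigma> = loc g \<sigma> * \<sigma> i - loc0 g * \<sigma> i - b * (1 - mag g i * \<sigma> i)"

lemma av_field:
  "av g (\<lambda>\<sigma>. field g \<sigma> * \<sigma> k) = av g (\<lambda>\<sigma>. loc g \<sigma> * (\<sigma> i * \<sigma> k)) - loc0 g * cor g k - b * (mag g k - mag g i * cor g k)"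
proof -
  have "av g (\<lambda>\<sigma>. field g \<sigma> * \<sigma> k) = av g (\<lambda>\<sigma>. loc g \<sigma> * (\<sigma> i * \<sigma> k) - loc0 g * (\<sigma> i * \<sigma> k)
      - b * (\<sigma> k - mag g i * (\<sigma> i * \<sigma> k)))"
    by (rule gavg1_cong) (simp add: field_def algebra_simps)
  then show ?thesis
    by (simp only: gavg1_add gavg1_diff gavg1_cmult cor_def mag_def)
qed

text \<open>Replacing the overlap by \<open>q\<close> in the derivative of \<open>cav\<close> leaves
  \<open>q\<close> times this average, so the defect is precisely the obstruction to an exact Stein
  identity.\<close>

lemma av_field_1: "av g (field g) = defect g"
proof -
  have "av g (field g) = av g (\<lambda>\<sigma>. loc g \<sigma> * \<sigma> i - loc0 g * \<sigma> i - b * (1 - mag g i * \<sigma> i))"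
    by (rule gavg1_cong) (simp add: field_def)
  then show ?thesis
    by (simp add: gavg1_diff gavg1_cmult defect_def loc1_def mag_def power2_eq_square)
qed

lemma partial_cav:
  assumes k: "k \<in> J"
  shows "partial_at (pairs N) (edge k) cav (\<lambda>g. \<epsilon> * mag g k + \<epsilon> * \<beta> * av g (\<lambda>\<sigma>. field g \<sigma> * \<sigma> k))"
  unfolding cav_def[abs_def]
  by (rule partial_at_cong[OF partial_at_diff[OF partial_loc0[OF k] partial_at_mult[OF partial_at_const partial_mag_site[OF k]]]])
    (simp only: av_field, simp add: algebra_simps)

section \<open>Integration by parts at the site and the second moment of the field\<close>

lemma by_parts_sum:
  assumes F: "\<And>k. k \<in> J \<Longrightarrow> partial_at (pairs N) (edge k) (F k) (F' k)"
  shows "EE (\<lambda>g. \<epsilon> * (\<Sum>k\<in>J. gs g i k * F k g)) = EE (\<lambda>g. \<epsilon> * (\<Sum>k\<in>J. F' k g))"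
proof -
  have tame: "tame (pairs N) (F k)" "tame (pairs N) (F' k)" if "k \<in> J" for k
    using F[OF that] by (auto simp: partial_at_def)
  have "EE (\<lambda>g. \<Sum>k\<in>J. gs g i k * F k g) = (\<Sum>k\<in>J. EE (\<lambda>g. gs g i k * F k g))"
    by (intro Bochner_Integration.integral_sum tame_integrable finite_pairs tame_mult tame_gs tame)
  also have "\<dots> = (\<Sum>k\<in>J. EE (F' k))"
    by (intro sum.cong refl)
      (simp add: gs_eq gaussian_vector_by_parts[OF finite_pairs edge_in_pairs F])
  also have "\<dots> = EE (\<lambda>g. \<Sum>k\<in>J. F' k g)"
    by (intro Bochner_Integration.integral_sum[symmetric] tame_integrable finite_pairs tame)
  finally show ?thesis by simp
qed

text \<open>One factor of the square is expanded in the couplings while the other stays inside the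
  Gibbs average, which gives the shape that \<open>by_parts_sum\<close> accepts.\<close>

lemma loc2_eq: "loc2 g = \<epsilon> * (\<Sum>k\<in>J. gs g i k * loc1 g k)"
proof -
  have "loc2 g = av g (\<lambda>\<sigma>. \<epsilon> * (\<Sum>k\<in>J. gs g i k * (loc g \<sigma> * \<sigma> k)))"
    unfolding loc2_def
  proof (rule gavg1_cong)
    fix \<sigma>
    have "(loc g \<sigma>)\<^sup>2 = loc g \<sigma> * (\<epsilon> * (\<Sum>k\<in>J. gs g i k * \<sigma> k))"
      by (simp only: power2_eq_square loc_def)
    also have "\<dots> = \<epsilon> * (\<Sum>k\<in>J. gs g i k * (loc g \<sigma> * \<sigma> k))" by (simp add: sum_distrib_left mult_ac)
    finally show "(loc g \<sigma>)\<^sup>2 = \<epsilon> * (\<Sum>k\<in>J. gs g i k * (loc g \<sigma> * \<sigma> k))" .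
  qed
  then show ?thesis by (simp add: gavg1_cmult gavg1_sum loc1_def)
qed

lemma loc0_eq: "loc0 g = \<epsilon> * (\<Sum>k\<in>J. gs g i k * mag g k)"
  unfolding loc0_def loc_def[abs_def] by (simp add: gavg1_cmult gavg1_sum mag_def)

lemma loc1_site_eq: "loc1 g i = \<epsilon> * (\<Sum>k\<in>J. gs g i k * cor g k)"
proof -
  have "loc1 g i = av g (\<lambda>\<sigma>. \<epsilon> * (\<Sum>k\<in>J. gs g i k * (\<sigma> i * \<sigma> k)))"
    unfolding loc1_def loc_def
    by (rule gavg1_cong) (simp add: sum_distrib_left sum_distrib_right mult_ac)
  then show ?thesis by (simp add: gavg1_cmult gavg1_sum cor_def)
qed

text \<open>The covariance of field and spin is a linear form in the couplings with coefficients
  \<open>cov g k\<close>; this is the factor of the squared defect that is integrated by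
  parts.\<close>

lemma loc_cov_eq: "loc1 g i - loc0 g * mag g i = \<epsilon> * (\<Sum>k\<in>J. gs g i k * cov g k)"
  unfolding loc1_site_eq loc0_eq cov_def
  by (simp add: right_diff_distrib sum_subtractf sum_distrib_right sum_distrib_left mult_ac)

lemma loc2_nonneg: "0 \<le> loc2 g" unfolding loc2_def by (intro gavg1_nonneg) simp

lemma loc_bounds: "\<bar>loc0 g\<bar> \<le> sqrt (loc2 g)" "k < N \<Longrightarrow> \<bar>loc1 g k\<bar> \<le> sqrt (loc2 g)"
proof -
  show "\<bar>loc0 g\<bar> \<le> sqrt (loc2 g)"
    unfolding loc0_def loc2_def by (rule order_trans[OF gavg1_abs gavg1_abs_le_sqrt])
  assume k: "k < N"
  have "\<bar>loc1 g k\<bar> \<le> av g (\<lambda>\<sigma>. \<bar>loc g \<sigma>\<bar>)"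
    unfolding loc1_def
    by (rule order_trans[OF gavg1_abs gavg1_mono]) (simp add: abs_mult spin_abs k)
  also have "\<dots> \<le> sqrt (loc2 g)" unfolding loc2_def by (rule gavg1_abs_le_sqrt)
  finally show "\<bar>loc1 g k\<bar> \<le> sqrt (loc2 g)" .
qed

lemma mag_bound: "k < N \<Longrightarrow> \<bar>mag g k\<bar> \<le> 1"
  using gavg1_mono[of N "\<lambda>\<sigma>. \<bar>\<sigma> k\<bar>" "\<lambda>_. 1" \<beta> h g] gavg1_abs[of N \<beta> h g "\<lambda>\<sigma>. \<sigma> k"]
  by (auto simp: mag_def spin_abs)

lemma cor_bound: "k < N \<Longrightarrow> \<bar>cor g k\<bar> \<le> 1"
  using gavg1_mono[of N "\<lambda>\<sigma>. \<bar>\<sigma> i * \<sigma> k\<bar>" "\<lambda>_. 1" \<beta> h g] gavg1_abs[of N \<beta> h g "\<lambda>\<sigma>. \<sigma> i * \<sigma> k"]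
  by (auto simp: cor_def spin_abs abs_mult site)

text \<open>Integration by parts bounds the second moment by the mean of
  \<open>1 + 2 * \<beta> * sqrt (loc2 g)\<close>. Half of \<open>loc2\<close> absorbs the root, and
  since the expectation is finite by tameness it can be moved to the other side.\<close>

lemma loc2_expectation: "EE loc2 \<le> 2 + 4 * \<beta>\<^sup>2"
proof -
  let ?D = "\<lambda>g k. \<epsilon> + \<epsilon> * \<beta> * (loc1 g i - loc1 g k * cor g k)"
  have "EE loc2 = EE (\<lambda>g. \<epsilon> * (\<Sum>k\<in>J. ?D g k))"
    unfolding loc2_eq using by_parts_sum[OF partial_loc1] by simp
  also have "\<dots> \<le> EE (\<lambda>g. 1 + 2 * \<beta>\<^sup>2 + 1/2 * loc2 g)"
  proof (intro integral_mono tame_integrable finite_pairs tame_intros tame_defs)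
    fix g
    let ?r = "sqrt (loc2 g)"
    have "?D g k \<le> \<epsilon> * (1 + 2 * \<beta> * ?r)" if k: "k \<in> J" for k
    proof -
      have kN: "k < N" using J_less[OF k] .
      have "\<bar>loc1 g k * cor g k\<bar> \<le> ?r * 1"
        unfolding abs_mult using loc_bounds(2)[OF kN] cor_bound[OF kN] by (intro mult_mono) (auto simp: loc2_nonneg)
      then have "loc1 g i - loc1 g k * cor g k \<le> 2 * ?r" using loc_bounds(2)[OF site, of g] by linarith
      then have "\<epsilon> * \<beta> * (loc1 g i - loc1 g k * cor g k) \<le> \<epsilon> * \<beta> * (2 * ?r)"
        using eps_pos beta_pos by (intro mult_left_mono) auto
      then show ?thesis by (simp add: algebra_simps)
    qed
    then have "\<epsilon> * (\<Sum>k\<in>J. ?D g k) \<le> \<epsilon> * (\<Sum>k\<in>J. \<epsilon> * (1 + 2 * \<beta> * ?r))"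
      using eps_pos by (intro mult_left_mono sum_mono) auto
    also have "\<dots> = (\<epsilon> * \<epsilon>) * real (card J) * (1 + 2 * \<beta> * ?r)" by simp
    also have "\<dots> = (1 - 1 / real N) * (1 + 2 * \<beta> * ?r)"
      unfolding eps_sq card_J[symmetric] by simp
    also have "\<dots> \<le> 1 * (1 + 2 * \<beta> * ?r)"
      using beta_pos loc2_nonneg[of g] by (intro mult_right_mono) auto
    also have "\<dots> \<le> 1 + 2 * \<beta>\<^sup>2 + 1/2 * loc2 g"
    proof -
      \<comment> \<open>This square gives
        \<open>2 * \<beta> * ?r \<le> 2 * \<beta>\<^sup>2 + loc2 g / 2\<close>; doubling after
        absorption yields \<open>2 + 4 * \<beta>\<^sup>2\<close>.\<close>
      have "0 \<le> (2 * \<beta> - ?r)\<^sup>2" by simp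
      then show ?thesis using loc2_nonneg[of g] by (simp add: power2_diff power_mult_distrib)
    qed
    finally show "\<epsilon> * (\<Sum>k\<in>J. ?D g k) \<le> 1 + 2 * \<beta>\<^sup>2 + 1/2 * loc2 g" .
  qed
  also have "\<dots> = 1 + 2 * \<beta>\<^sup>2 + 1/2 * EE loc2"
  proof -
    interpret prob_space "gaussian_vector (pairs N)" by (rule prob_space_gaussian_vector)
    show ?thesis
      using tame_integrable[OF finite_pairs tame_defs(5)] prob_space by simp
  qed
  finally show ?thesis by simp
qed

section \<open>Sums over sites controlled by overlap fluctuations\<close>

lemma dev_eq: "dev g \<tau> = av g (\<lambda>\<sigma>. ov \<tau> \<sigma> - q)"
  unfolding dev_def ov_def by (simp add: gavg1_linear mag_def mult.commute)

text \<open>The factor \<open>\<sigma> i - mag g i\<close> is centred, so \<open>q\<close> can be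
  subtracted from the overlap at no cost. This makes \<open>rho\<close> as small as the overlap
  fluctuation rather than merely bounded.\<close>

lemma rho_eq: "rho g \<tau> = av g (\<lambda>\<sigma>. (\<sigma> i - mag g i) * (ov \<tau> \<sigma> - q))"
proof -
  have "av g (\<lambda>\<sigma>. (\<sigma> i - mag g i) * (ov \<tau> \<sigma> - q))
      = av g (\<lambda>\<sigma>. (\<Sum>k\<in>J. (\<sigma> i * \<sigma> k) * \<tau> k) / real N - \<sigma> i * q - mag g i * ((\<Sum>k\<in>J. \<tau> k * \<sigma> k) / real N) + mag g i * q)"
    by (rule gavg1_cong)
      (simp add: ov_def left_diff_distrib right_diff_distrib sum_distrib_left sum_subtractf diff_divide_distrib mult_ac)
  also have "\<dots> = (\<Sum>k\<in>J. cor g k * \<tau> k) / real N - mag g i * ((\<Sum>k\<in>J. \<tau> k * mag g k) / real N)"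
    by (simp add: gavg1_linear cor_def mag_def[symmetric])
  also have "\<dots> = rho g \<tau>"
    unfolding rho_def cov_def
    by (simp add: diff_divide_distrib[symmetric] left_diff_distrib right_diff_distrib sum_subtractf sum_distrib_left mult_ac)
  finally show ?thesis ..
qed

lemma kappa_ge: "1 / real N \<le> \<kappa> g" "0 \<le> av g (\<lambda>\<sigma>. av g (\<lambda>\<tau>. (ov \<sigma> \<tau> - q)\<^sup>2))"
proof -
  show "0 \<le> av g (\<lambda>\<sigma>. av g (\<lambda>\<tau>. (ov \<sigma> \<tau> - q)\<^sup>2))" by (intro gavg1_nonneg) simp
  then show "1 / real N \<le> \<kappa> g" by (simp add: \<kappa>_def)
qed

lemma kappa_pos: "0 < \<kappa> g"
  using kappa_ge(1)[of g] N_pos by (meson less_le_trans zero_less_divide_1_iff)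

lemma inverse_N_le: "1 / real N \<le> sqrt (\<kappa> g)"
proof -
  have "1 / real N \<le> sqrt (1 / real N)"
  proof (rule real_le_rsqrt)
    have "1 \<le> real N" using site by simp
    then show "(1 / real N)\<^sup>2 \<le> 1 / real N"
      by (simp add: power_divide power2_eq_square divide_simps)
  qed
  also have "\<dots> \<le> sqrt (\<kappa> g)" using kappa_ge(1) by simp
  finally show ?thesis .
qed

lemma av_dev_sq: "sqrt (av g (\<lambda>\<sigma>. (dev g \<sigma>)\<^sup>2)) \<le> sqrt (\<kappa> g)"
proof -
  have "av g (\<lambda>\<sigma>. (dev g \<sigma>)\<^sup>2) \<le> av g (\<lambda>\<sigma>. av g (\<lambda>\<tau>. (ov \<sigma> \<tau> - q)\<^sup>2))"
    unfolding dev_eq by (intro gavg1_mono gavg1_square_le)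
  also have "\<dots> \<le> \<kappa> g" by (simp add: \<kappa>_def)
  finally show ?thesis by simp
qed

lemma av_rho_sq: "sqrt (av g (\<lambda>\<sigma>. (rho g \<sigma>)\<^sup>2)) \<le> 2 * sqrt (\<kappa> g)"
proof -
  have "(rho g \<sigma>)\<^sup>2 \<le> 4 * av g (\<lambda>\<tau>. (ov \<sigma> \<tau> - q)\<^sup>2)" for \<sigma>
  proof -
    have "(rho g \<sigma>)\<^sup>2 \<le> av g (\<lambda>\<tau>. ((\<tau> i - mag g i) * (ov \<sigma> \<tau> - q))\<^sup>2)"
      unfolding rho_eq by (rule gavg1_square_le)
    also have "\<dots> \<le> av g (\<lambda>\<tau>. 4 * (ov \<sigma> \<tau> - q)\<^sup>2)"
    proof (rule gavg1_mono)
      fix \<tau> assume "\<tau> \<in> spins N"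
      then have "\<bar>\<tau> i - mag g i\<bar> \<le> 2" using spin_abs[of \<tau> N i] mag_bound[of i g] site by linarith
      then have "(\<tau> i - mag g i)\<^sup>2 \<le> 2\<^sup>2" using abs_le_square_iff[of "\<tau> i - mag g i" 2] by simp
      then show "((\<tau> i - mag g i) * (ov \<sigma> \<tau> - q))\<^sup>2 \<le> 4 * (ov \<sigma> \<tau> - q)\<^sup>2"
        unfolding power_mult_distrib by (intro mult_right_mono) auto
    qed
    finally show ?thesis by (simp add: gavg1_cmult)
  qed
  then have "av g (\<lambda>\<sigma>. (rho g \<sigma>)\<^sup>2) \<le> av g (\<lambda>\<sigma>. 4 * av g (\<lambda>\<tau>. (ov \<sigma> \<tau> - q)\<^sup>2))"
    by (intro gavg1_mono)
  also have "\<dots> \<le> 4 * \<kappa> g" by (simp add: \<kappa>_def gavg1_cmult)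
  finally have "sqrt (av g (\<lambda>\<sigma>. (rho g \<sigma>)\<^sup>2)) \<le> sqrt (4 * \<kappa> g)" by simp
  then show ?thesis by (simp add: real_sqrt_mult)
qed

lemma av_dev_bound:
  assumes F: "\<And>\<sigma>. \<sigma> \<in> spins N \<Longrightarrow> \<bar>F \<sigma>\<bar> \<le> a * \<bar>loc g \<sigma>\<bar> + c" and a: "0 \<le> a" and c: "0 \<le> c"
  shows "\<bar>av g (\<lambda>\<sigma>. F \<sigma> * dev g \<sigma>)\<bar> \<le> (a * sqrt (loc2 g) + c) * sqrt (\<kappa> g)"
proof -
  have "\<bar>av g (\<lambda>\<sigma>. F \<sigma> * dev g \<sigma>)\<bar> \<le> (a * sqrt (loc2 g) + c) * sqrt (av g (\<lambda>\<sigma>. (dev g \<sigma>)\<^sup>2))"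
    unfolding loc2_def by (rule gavg1_mult_bound[OF F a c])
  also have "\<dots> \<le> (a * sqrt (loc2 g) + c) * sqrt (\<kappa> g)"
    using a c loc2_nonneg[of g] by (intro mult_left_mono av_dev_sq) auto
  finally show ?thesis .
qed

lemma av_rho_bound:
  assumes F: "\<And>\<sigma>. \<sigma> \<in> spins N \<Longrightarrow> \<bar>F \<sigma>\<bar> \<le> a * \<bar>loc g \<sigma>\<bar> + c" and a: "0 \<le> a" and c: "0 \<le> c"
  shows "\<bar>av g (\<lambda>\<sigma>. F \<sigma> * rho g \<sigma>)\<bar> \<le> (a * sqrt (loc2 g) + c) * (2 * sqrt (\<kappa> g))"
proof -
  have "\<bar>av g (\<lambda>\<sigma>. F \<sigma> * rho g \<sigma>)\<bar> \<le> (a * sqrt (loc2 g) + c) * sqrt (av g (\<lambda>\<sigma>. (rho g \<sigma>)\<^sup>2))"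
    unfolding loc2_def by (rule gavg1_mult_bound[OF F a c])
  also have "\<dots> \<le> (a * sqrt (loc2 g) + c) * (2 * sqrt (\<kappa> g))"
    using a c loc2_nonneg[of g] by (intro mult_left_mono av_rho_sq) auto
  finally show ?thesis .
qed

lemma magsq_eq: "magsq g - q = av g (dev g)"
proof -
  have "av g (dev g) = av g (\<lambda>\<tau>. (\<Sum>k\<in>J. mag g k * \<tau> k) / real N - q)"
    by (rule gavg1_cong) (simp add: dev_def)
  then show ?thesis by (simp add: gavg1_linear magsq_def mag_def)
qed

lemma magsq_bound: "\<bar>magsq g - q\<bar> \<le> sqrt (\<kappa> g)"
  unfolding magsq_eq using av_dev_bound[of "\<lambda>_. 1" 0 g 1] by simp

text \<open>One factor \<open>cov g k\<close> is unfolded as a Gibbs average against the centred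
  spin; the other weights the sum and becomes \<open>rho\<close>. Smallness of \<open>rho\<close> is
  thereby inherited.\<close>

lemma covsq_eq: "covsq g = av g (\<lambda>\<tau>. (\<tau> i - mag g i) * rho g \<tau>)"
proof -
  have "av g (\<lambda>\<tau>. (\<tau> i - mag g i) * rho g \<tau>)
      = av g (\<lambda>\<tau>. (\<Sum>k\<in>J. cov g k * (\<tau> i * \<tau> k - mag g i * \<tau> k)) / real N)"
    by (rule gavg1_cong) (simp add: rho_def left_diff_distrib right_diff_distrib sum_subtractf sum_distrib_left
        diff_divide_distrib mult_ac)
  also have "\<dots> = (\<Sum>k\<in>J. cov g k * (cor g k - mag g i * mag g k)) / real N"
    by (simp add: gavg1_linear cor_def mag_def[symmetric])
  also have "\<dots> = covsq g" unfolding covsq_def by (simp add: cov_def mult.commute)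
  finally show ?thesis ..
qed

lemma covsq_bound: "\<bar>covsq g\<bar> \<le> 4 * sqrt (\<kappa> g)"
  unfolding covsq_eq
proof -
  have "\<bar>\<sigma> i - mag g i\<bar> \<le> 0 * \<bar>loc g \<sigma>\<bar> + 2" if "\<sigma> \<in> spins N" for \<sigma>
    using spin_abs[OF that site] mag_bound[OF site, of g] by linarith
  from av_rho_bound[OF this]
  show "\<bar>av g (\<lambda>\<tau>. (\<tau> i - mag g i) * rho g \<tau>)\<bar> \<le> 4 * sqrt (\<kappa> g)" by simp
qed

section \<open>Pointwise bounds and the error scale\<close>

lemma b_bounds: "0 \<le> b" "b \<le> \<beta>"
  using beta_pos q_pos q_less by (auto simp: b_def mult_left_le)

lemma mag_sq_bounds: "0 \<le> 1 - (mag g i)\<^sup>2" "1 - (mag g i)\<^sup>2 \<le> 1"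
  using mag_bound[OF site, of g] by (auto simp: abs_square_le_1)

lemma defect_bound: "\<bar>defect g\<bar> \<le> 2 * sqrt (loc2 g) + \<beta>"
proof -
  have "\<bar>loc0 g * mag g i\<bar> \<le> sqrt (loc2 g) * 1"
    unfolding abs_mult using loc_bounds(1) mag_bound[OF site] loc2_nonneg by (intro mult_mono) auto
  moreover have "\<bar>b * (1 - (mag g i)\<^sup>2)\<bar> \<le> \<beta> * 1"
    unfolding abs_mult using mag_sq_bounds[of g] b_bounds by (intro mult_mono) auto
  ultimately show ?thesis using loc_bounds(2)[OF site, of g] unfolding defect_def by linarith
qed

lemma tilt_bound:
  assumes \<sigma>: "\<sigma> \<in> spins N"
  shows "\<bar>tilt g \<sigma>\<bar> \<le> 2 * \<bar>loc g \<sigma>\<bar> + (4 * sqrt (loc2 g) + 4 * \<beta>)"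
proof -
  let ?r = "sqrt (loc2 g)"
  have r: "0 \<le> ?r" using loc2_nonneg by simp
  have s: "\<bar>\<sigma> i\<bar> = 1" by (rule spin_abs[OF \<sigma> site])
  have m: "\<bar>mag g i\<bar> \<le> 1" by (rule mag_bound[OF site])
  have "\<bar>loc1 g i * \<sigma> i\<bar> \<le> ?r" using loc_bounds(2)[OF site] by (simp add: abs_mult s)
  moreover have "\<bar>mag g i * (loc g \<sigma> * \<sigma> i)\<bar> \<le> 1 * \<bar>loc g \<sigma>\<bar>"
    using mult_right_mono[OF m abs_ge_zero[of "loc g \<sigma>"]] by (simp add: abs_mult s)
  moreover have "\<bar>2 * loc0 g * mag g i * \<sigma> i\<bar> \<le> 2 * ?r"
    using mult_mono[OF loc_bounds(1)[of g] m r abs_ge_zero] by (simp add: abs_mult s)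
  moreover have "\<bar>2 * b * mag g i * (1 - mag g i * \<sigma> i)\<bar> \<le> 4 * \<beta>"
  proof -
    have "\<bar>mag g i * \<sigma> i\<bar> \<le> 1" using m by (simp add: abs_mult s)
    then have "\<bar>1 - mag g i * \<sigma> i\<bar> \<le> 2" by linarith
    moreover have "\<bar>b * mag g i\<bar> \<le> \<beta> * 1" unfolding abs_mult using b_bounds m by (intro mult_mono) auto
    ultimately have "\<bar>b * mag g i\<bar> * \<bar>1 - mag g i * \<sigma> i\<bar> \<le> (\<beta> * 1) * 2"
      using beta_pos by (intro mult_mono) auto
    then show ?thesis by (simp add: abs_mult mult.assoc)
  qed
  moreover have "\<bar>loc0 g\<bar> \<le> ?r" by (rule loc_bounds(1))
  ultimately show ?thesis unfolding tilt_def by linarith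
qed

lemma field_bound:
  assumes \<sigma>: "\<sigma> \<in> spins N"
  shows "\<bar>field g \<sigma>\<bar> \<le> 1 * \<bar>loc g \<sigma>\<bar> + (sqrt (loc2 g) + 2 * \<beta>)"
proof -
  have s: "\<bar>\<sigma> i\<bar> = 1" by (rule spin_abs[OF \<sigma> site])
  have m: "\<bar>mag g i\<bar> \<le> 1" by (rule mag_bound[OF site])
  have "\<bar>loc g \<sigma> * \<sigma> i\<bar> = \<bar>loc g \<sigma>\<bar>" by (simp add: abs_mult s)
  moreover have "\<bar>loc0 g * \<sigma> i\<bar> \<le> sqrt (loc2 g)" using loc_bounds(1) by (simp add: abs_mult s)
  moreover have "\<bar>b * (1 - mag g i * \<sigma> i)\<bar> \<le> \<beta> * 2"
  proof -
    have "\<bar>mag g i * \<sigma> i\<bar> \<le> 1" using m by (simp add: abs_mult s)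
    then have "\<bar>1 - mag g i * \<sigma> i\<bar> \<le> 2" by linarith
    then show ?thesis unfolding abs_mult using b_bounds by (intro mult_mono) auto
  qed
  ultimately show ?thesis unfolding field_def by linarith
qed

text \<open>AM-GM at the scale \<open>\<epsilon>\<close> turns all error terms into a linear expression in \<open>loc2\<close> and \<open>\<kappa>\<close>,
  whose expectation is known.\<close>

lemma error_bound:
  "(1 + sqrt (loc2 g)) * sqrt (\<kappa> g) \<le> \<epsilon> * (1 + loc2 g) + \<kappa> g / \<epsilon>"
proof -
  let ?r = "sqrt (loc2 g)" and ?k = "sqrt (\<kappa> g)"
  have sq: "?r * ?r = loc2 g" "?k * ?k = \<kappa> g" using loc2_nonneg kappa_pos[of g] by auto
  have 1: "0 \<le> (\<epsilon> * (1 + ?r) - ?k)\<^sup>2" and 2: "0 \<le> \<epsilon> * \<epsilon> * (1 - ?r)\<^sup>2" by simp_all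
  have "2 * \<epsilon> * (1 + ?r) * ?k \<le> \<epsilon> * \<epsilon> * (1 + ?r)\<^sup>2 + \<kappa> g"
    using 1 sq(2) by (simp add: power2_eq_square algebra_simps)
  also have "\<dots> \<le> \<epsilon> * \<epsilon> * (2 * (1 + loc2 g)) + \<kappa> g"
    using 2 sq(1) by (simp add: power2_eq_square algebra_simps)
  finally have "\<epsilon> * (2 * ((1 + ?r) * ?k)) \<le> \<epsilon> * (2 * \<epsilon> * (1 + loc2 g) + \<kappa> g / \<epsilon>)"
    using eps_pos by (simp add: algebra_simps)
  then have "2 * ((1 + ?r) * ?k) \<le> 2 * \<epsilon> * (1 + loc2 g) + \<kappa> g / \<epsilon>"
    using eps_pos by (simp only: mult_le_cancel_left_pos)
  moreover have "0 \<le> \<kappa> g / \<epsilon>" using kappa_pos[of g] eps_pos by simp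
  ultimately show ?thesis by simp
qed

lemma tame_error: "tame (pairs N) (\<lambda>g. \<epsilon> * (1 + loc2 g) + \<kappa> g / \<epsilon>)"
  unfolding divide_inverse by (intro tame_intros tame_defs)

text \<open>Both summands have size \<epsilon>: the first since the field has bounded second moment,
  the second since the mean of \<kappa> is of order \<open>\<epsilon> * \<epsilon>\<close>.\<close>

lemma expectation_error:
  assumes "EE \<kappa> \<le> K / real N"
  shows "EE (\<lambda>g. \<epsilon> * (1 + loc2 g) + \<kappa> g / \<epsilon>) \<le> (3 + 4 * \<beta>\<^sup>2 + K) * \<epsilon>"
proof -
  interpret prob_space "gaussian_vector (pairs N)" by (rule prob_space_gaussian_vector)
  have "EE (\<lambda>g. \<epsilon> * (1 + loc2 g) + \<kappa> g / \<epsilon>) = \<epsilon> * (1 + EE loc2) + EE \<kappa> / \<epsilon>"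
    using tame_integrable[OF finite_pairs tame_defs(5)] tame_integrable[OF finite_pairs tame_defs(6)] prob_space
    by simp
  also have "\<dots> \<le> \<epsilon> * (1 + (2 + 4 * \<beta>\<^sup>2)) + (K / real N) / \<epsilon>"
    using loc2_expectation eps_pos assms
    by (intro add_mono mult_left_mono divide_right_mono) auto
  also have "(K / real N) / \<epsilon> = (K * (\<epsilon> * \<epsilon>)) / \<epsilon>" unfolding eps_sq by simp
  also have "\<dots> = K * \<epsilon>" using eps_pos by simp
  finally show ?thesis by (simp add: algebra_simps)
qed

text \<open>One factor of the square is the linear form of \<open>loc_cov_eq\<close> minus its
  limiting value. Integrating the linear form by parts, the derivative of \<open>cov\<close>
  reproduces that limiting value and cancels it. The derivative of the other factor is paired with
  \<open>cov\<close>, so it meets \<open>rho\<close> and \<open>covsq\<close>, both of order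
  \<open>sqrt (\<kappa> g)\<close>.\<close>

lemma defect_expectation:
  assumes K: "EE \<kappa> \<le> K / real N"
  shows "EE (\<lambda>g. (defect g)\<^sup>2) \<le> (4 + 24 * \<beta> + 14 * \<beta>\<^sup>2) * ((3 + 4 * \<beta>\<^sup>2 + K) * \<epsilon>)"
proof -
  interpret prob_space "gaussian_vector (pairs N)" by (rule prob_space_gaussian_vector)
  let ?D = "\<lambda>g k. \<epsilon> * \<beta> * ((1 - (mag g i)\<^sup>2) * (1 - mag g k * mag g k) - cov g k * cov g k)"
  let ?G = "\<lambda>g k. \<epsilon> * cov g k + \<epsilon> * \<beta> * av g (\<lambda>\<sigma>. tilt g \<sigma> * \<sigma> k)"
  define Y where "Y g = \<epsilon> * (\<Sum>k\<in>J. ?D g k * defect g + cov g k * ?G g k)" for g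
  define C where "C = 4 + 24 * \<beta> + 14 * \<beta>\<^sup>2"
  have part: "partial_at (pairs N) (edge k) (\<lambda>g. cov g k * defect g) (\<lambda>g. ?D g k * defect g + cov g k * ?G g k)"
    if "k \<in> J" for k
    by (intro partial_at_mult partial_cov partial_defect that)
  have tY: "tame (pairs N) Y"
    unfolding Y_def[abs_def] by (rule tame_mult[OF tame_const tame_sum[OF partial_at_tame[OF part]]])
  let ?Z = "\<lambda>g. defect g * (b * (1 - (mag g i)\<^sup>2))"
  have tZ: "tame (pairs N) ?Z" by (intro tame_intros tame_defect tame_defs)
  have "EE (\<lambda>g. \<epsilon> * (\<Sum>k\<in>J. gs g i k * (cov g k * defect g))) = EE Y"
    unfolding Y_def by (rule by_parts_sum[OF part])
  moreover have "\<epsilon> * (\<Sum>k\<in>J. gs g i k * (cov g k * defect g)) = (defect g)\<^sup>2 + ?Z g" for g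
  proof -
    have "\<epsilon> * (\<Sum>k\<in>J. gs g i k * (cov g k * defect g)) = (loc1 g i - loc0 g * mag g i) * defect g"
      unfolding loc_cov_eq by (simp add: sum_distrib_left sum_distrib_right mult_ac)
    then show ?thesis by (simp add: defect_def power2_eq_square algebra_simps)
  qed
  ultimately have "EE (\<lambda>g. (defect g)\<^sup>2 + ?Z g) = EE Y" by simp
  moreover have "EE (\<lambda>g. (defect g)\<^sup>2 + ?Z g) = EE (\<lambda>g. (defect g)\<^sup>2) + EE ?Z"
    by (intro Bochner_Integration.integral_add tame_integrable finite_pairs tame_power tame_defect tZ)
  \<comment> \<open>The two integrals are recombined under one expectation because \<open>Y\<close>
    and \<open>?Z\<close> are each of order one; the cancellation has to happen before absolute
    values are taken.\<close>
  moreover have "EE (\<lambda>g. Y g - ?Z g) = EE Y - EE ?Z"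
    by (intro Bochner_Integration.integral_diff tame_integrable finite_pairs tY tZ)
  ultimately have "EE (\<lambda>g. (defect g)\<^sup>2) = EE (\<lambda>g. Y g - ?Z g)" by simp
  also have "\<dots> \<le> EE (\<lambda>g. C * (\<epsilon> * (1 + loc2 g) + \<kappa> g / \<epsilon>))"
  proof (intro integral_mono tame_integrable finite_pairs tame_diff tY tZ tame_mult tame_const tame_error)
    fix g
    let ?r = "sqrt (loc2 g)" and ?k = "sqrt (\<kappa> g)" and ?u = "1 - (mag g i)\<^sup>2"
    have r: "0 \<le> ?r" "0 \<le> ?k" using loc2_nonneg kappa_pos[of g] by auto
    have sD: "\<epsilon> * (\<Sum>k\<in>J. ?D g k) = \<beta> * (?u * (1 - 1 / real N - magsq g) - covsq g)"
    proof -
      have "\<epsilon> * (\<Sum>k\<in>J. ?D g k) = (\<epsilon> * \<epsilon>) * \<beta> * (\<Sum>k\<in>J. ?u * (1 - mag g k * mag g k) - cov g k * cov g k)"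
        by (simp add: sum_distrib_left mult.assoc)
      also have "(\<Sum>k\<in>J. ?u * (1 - mag g k * mag g k) - cov g k * cov g k)
          = ?u * (\<Sum>k\<in>J. 1 - mag g k * mag g k) - (\<Sum>k\<in>J. cov g k * cov g k)"
        unfolding sum_distrib_left by (rule sum_subtractf)
      also have "(\<epsilon> * \<epsilon>) * \<beta> * \<dots> = \<beta> * (?u * ((\<Sum>k\<in>J. 1 - mag g k * mag g k) / real N) - covsq g)"
        unfolding eps_sq covsq_def by (simp add: right_diff_distrib diff_divide_distrib)
      also have "(\<Sum>k\<in>J. 1 - mag g k * mag g k) / real N = 1 - 1 / real N - magsq g"
        unfolding magsq_def card_J[symmetric] by (simp add: sum_subtractf diff_divide_distrib)
      finally show ?thesis .
    qed
    \<comment> \<open>Moving the weights \<open>cov g k\<close> inside the Gibbs average turns the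
      sum over neighbours into a single average of \<open>tilt\<close> against the small quantity
      \<open>rho\<close>.\<close>
    have sG: "\<epsilon> * (\<Sum>k\<in>J. cov g k * ?G g k) = covsq g + \<beta> * av g (\<lambda>\<sigma>. tilt g \<sigma> * rho g \<sigma>)"
    proof -
      have 1: "av g (\<lambda>\<sigma>. tilt g \<sigma> * rho g \<sigma>) = (\<Sum>k\<in>J. cov g k * av g (\<lambda>\<sigma>. tilt g \<sigma> * \<sigma> k)) / real N"
      proof -
        have "av g (\<lambda>\<sigma>. tilt g \<sigma> * rho g \<sigma>) = av g (\<lambda>\<sigma>. (\<Sum>k\<in>J. cov g k * (tilt g \<sigma> * \<sigma> k)) / real N)"
          by (rule gavg1_cong) (simp add: rho_def sum_distrib_left mult_ac)
        then show ?thesis by (simp add: gavg1_divide gavg1_sum gavg1_cmult)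
      qed
      have "\<epsilon> * (\<Sum>k\<in>J. cov g k * ?G g k)
          = (\<epsilon> * \<epsilon>) * (\<Sum>k\<in>J. cov g k * cov g k) + (\<epsilon> * \<epsilon>) * \<beta> * (\<Sum>k\<in>J. cov g k * av g (\<lambda>\<sigma>. tilt g \<sigma> * \<sigma> k))"
        by (simp add: sum_distrib_left distrib_left sum.distrib mult_ac)
      then show ?thesis unfolding 1 eps_sq covsq_def by simp
    qed
    \<comment> \<open>The cancellation: \<open>\<beta> * (1 - magsq g) - b\<close> equals
      \<open>\<beta> * (q - magsq g)\<close>, an overlap error.\<close>
    have "Y g - ?Z g = \<beta> * defect g * (?u * (q - magsq g - 1 / real N) - covsq g)
        + covsq g + \<beta> * av g (\<lambda>\<sigma>. tilt g \<sigma> * rho g \<sigma>)"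
    proof -
      have "Y g = (\<epsilon> * (\<Sum>k\<in>J. ?D g k)) * defect g + \<epsilon> * (\<Sum>k\<in>J. cov g k * ?G g k)"
        unfolding Y_def sum.distrib by (simp add: sum_distrib_right distrib_left mult.assoc)
      then show ?thesis unfolding sD sG by (simp add: b_def algebra_simps)
    qed
    \<comment> \<open>The 6 counts one for \<open>magsq\<close>, one for \<open>1 / N\<close> and
      four for \<open>covsq\<close>.\<close>
    moreover have "\<bar>\<beta> * defect g * (?u * (q - magsq g - 1 / real N) - covsq g)\<bar> \<le> \<beta> * (2 * ?r + \<beta>) * (6 * ?k)"
    proof -
      have "0 \<le> 1 / real N" by simp
      then have "\<bar>q - magsq g - 1 / real N\<bar> \<le> 2 * ?k"
        using magsq_bound[of g] inverse_N_le[of g] by linarith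
      then have "\<bar>?u * (q - magsq g - 1 / real N)\<bar> \<le> 1 * (2 * ?k)"
        unfolding abs_mult using mag_sq_bounds[of g] by (intro mult_mono) auto
      then have "\<bar>?u * (q - magsq g - 1 / real N) - covsq g\<bar> \<le> 6 * ?k"
        using covsq_bound[of g] by linarith
      then show ?thesis
        unfolding abs_mult using defect_bound[of g] beta_pos r by (intro mult_mono) auto
    qed
    moreover have "\<bar>\<beta> * av g (\<lambda>\<sigma>. tilt g \<sigma> * rho g \<sigma>)\<bar> \<le> \<beta> * ((2 * ?r + (4 * ?r + 4 * \<beta>)) * (2 * ?k))"
      unfolding abs_mult using beta_pos r av_rho_bound[OF tilt_bound, of g]
      by (simp only: abs_of_pos) (intro mult_left_mono, auto)
    moreover have "covsq g \<le> 4 * ?k" using covsq_bound[of g] by linarith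
    ultimately have "Y g - ?Z g \<le> \<beta> * (2 * ?r + \<beta>) * (6 * ?k) + 4 * ?k + \<beta> * ((2 * ?r + (4 * ?r + 4 * \<beta>)) * (2 * ?k))"
      by linarith
    \<comment> \<open>The coefficients collect as 24 = 12 + 12 and 14 = 6 + 8 from the defect and
      tilt terms, with 4 from \<open>covsq\<close>.\<close>
    also have "\<dots> = (4 + 24 * \<beta> * ?r + 14 * \<beta>\<^sup>2) * ?k" by (simp add: power2_eq_square algebra_simps)
    also have "\<dots> \<le> (C * (1 + ?r)) * ?k"
      using beta_pos r by (intro mult_right_mono) (auto simp: C_def algebra_simps)
    also have "\<dots> \<le> C * (\<epsilon> * (1 + loc2 g) + \<kappa> g / \<epsilon>)"
      unfolding mult.assoc using beta_pos by (intro mult_left_mono error_bound) (simp add: C_def)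
    finally show "Y g - ?Z g \<le> C * (\<epsilon> * (1 + loc2 g) + \<kappa> g / \<epsilon>)" .
  qed
  also have "\<dots> = C * EE (\<lambda>g. \<epsilon> * (1 + loc2 g) + \<kappa> g / \<epsilon>)" by simp
  also have "\<dots> \<le> C * ((3 + 4 * \<beta>\<^sup>2 + K) * \<epsilon>)"
    using beta_pos by (intro mult_left_mono expectation_error K) (simp add: C_def)
  finally show ?thesis unfolding C_def .
qed

text \<open>After integration by parts, the response of the magnetizations cancels the reaction term
  of \<open>cav\<close>, and the response of \<open>f (cav g)\<close> supplies
  \<open>q * f'\<close>. What remains is of order \<epsilon>, except for
  \<open>\<beta> * q * defect g * f'\<close>: the defect is known only in mean square, and this term
  sets the order \<open>sqrt \<epsilon>\<close>.\<close>

lemma stein_bound: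
  assumes K: "EE \<kappa> \<le> K / real N" "0 \<le> K"
    and df: "\<And>y::real. (f has_real_derivative f' y) (at y)" and f': "f' \<in> borel_measurable borel"
    and A: "\<And>y. \<bar>f y\<bar> \<le> A" and A': "\<And>y. \<bar>f' y\<bar> \<le> A'"
  defines "M \<equiv> 3 + 4 * \<beta>\<^sup>2 + K"
  shows "\<bar>EE (\<lambda>g. q * f' (cav g) - cav g * f (cav g))\<bar>
    \<le> ((2 * \<beta> * A + A' * (1 + 2 * \<beta> + 2 * \<beta>\<^sup>2)) * M
        + A' * \<beta> * (1 + (4 + 24 * \<beta> + 14 * \<beta>\<^sup>2) * M)) * sqrt \<epsilon>"
proof -
  interpret prob_space "gaussian_vector (pairs N)" by (rule prob_space_gaussian_vector)
  define P where "P = 2 * \<beta> * A + A' * (1 + 2 * \<beta> + 2 * \<beta>\<^sup>2)"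
  have A0: "0 \<le> A" "0 \<le> A'" using A[of 0] A'[of 0] by linarith+
  have P0: "0 \<le> P" using A0 beta_pos by (simp add: P_def)
  let ?err = "\<lambda>g. \<epsilon> * (1 + loc2 g) + \<kappa> g / \<epsilon>"
  let ?D = "\<lambda>g k. \<epsilon> * \<beta> * (mag g i - mag g k * cor g k)"
  let ?G = "\<lambda>g k. f' (cav g) * (\<epsilon> * mag g k + \<epsilon> * \<beta> * av g (\<lambda>\<sigma>. field g \<sigma> * \<sigma> k))"
  define Y where "Y g = \<epsilon> * (\<Sum>k\<in>J. ?D g k * f (cav g) + mag g k * ?G g k)" for g
  have part: "partial_at (pairs N) (edge k) (\<lambda>g. mag g k * f (cav g))
      (\<lambda>g. ?D g k * f (cav g) + mag g k * ?G g k)" if "k \<in> J" for k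
    by (rule partial_at_mult[OF partial_mag[OF that] partial_at_compose[OF partial_cav[OF that] df f' A A']])
  have tY: "tame (pairs N) Y"
    unfolding Y_def[abs_def] by (rule tame_mult[OF tame_const tame_sum[OF partial_at_tame[OF part]]])
  have f_meas: "f \<in> borel_measurable borel"
    using df by (intro borel_measurable_continuous_onI) (meson DERIV_isCont continuous_at_imp_continuous_on)
  have cav_meas: "cav \<in> borel_measurable (gaussian_vector (pairs N))"
    by (rule tame_measurable[OF tame_cav])
  have tf: "tame (pairs N) (\<lambda>g. f (cav g))" "tame (pairs N) (\<lambda>g. f' (cav g))"
    by (rule tame_bounded[OF measurable_compose[OF cav_meas f_meas] A],
        rule tame_bounded[OF measurable_compose[OF cav_meas f'] A'])
  have "EE (\<lambda>g. loc0 g * f (cav g)) = EE (\<lambda>g. \<epsilon> * (\<Sum>k\<in>J. gs g i k * (mag g k * f (cav g))))"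
    by (simp add: loc0_eq sum_distrib_left sum_distrib_right mult_ac)
  also have "\<dots> = EE Y" unfolding Y_def by (rule by_parts_sum[OF part])
  finally have parts: "EE (\<lambda>g. loc0 g * f (cav g)) = EE Y" .
  define R where "R g = q * f' (cav g) + b * mag g i * f (cav g) - Y g" for g
  have tR: "tame (pairs N) R" unfolding R_def[abs_def] by (intro tame_intros tame_defs tf tY)
  have "EE (\<lambda>g. q * f' (cav g) - cav g * f (cav g))
      = EE (\<lambda>g. (q * f' (cav g) + b * mag g i * f (cav g)) - loc0 g * f (cav g))"
    by (simp add: cav_def algebra_simps)
  also have "\<dots> = EE (\<lambda>g. q * f' (cav g) + b * mag g i * f (cav g)) - EE (\<lambda>g. loc0 g * f (cav g))"
    by (intro Bochner_Integration.integral_diff tame_integrable finite_pairs tame_intros tame_defs tf)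
  also have "\<dots> = EE R"
    unfolding parts R_def
    by (intro Bochner_Integration.integral_diff[symmetric] tame_integrable finite_pairs tame_intros tame_defs tf tY)
  finally have eq: "EE (\<lambda>g. q * f' (cav g) - cav g * f (cav g)) = EE R" .
  have R_le: "\<bar>R g\<bar> \<le> P * ?err g + A' * \<beta> * \<bar>defect g\<bar>" for g
  proof -
    let ?r = "sqrt (loc2 g)" and ?k = "sqrt (\<kappa> g)" and ?f = "f (cav g)" and ?f' = "f' (cav g)"
    have r: "0 \<le> ?r" "0 \<le> ?k" using loc2_nonneg kappa_pos[of g] by auto
    have avg: "(\<Sum>k\<in>J. mag g k * \<sigma> k) / real N = dev g \<sigma> + q" for \<sigma> by (simp add: dev_def)
    \<comment> \<open>The averaged response of the magnetizations is
      \<open>\<beta> * (1 - q) * mag g i\<close> up to overlap error, that is,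
      \<open>b * mag g i\<close>.\<close>
    have 1: "\<epsilon> * (\<Sum>k\<in>J. ?D g k) = \<beta> * ((1 - 1 / real N) * mag g i - (av g (\<lambda>\<sigma>. \<sigma> i * dev g \<sigma>) + q * mag g i))"
    proof -
      have "av g (\<lambda>\<sigma>. \<sigma> i * dev g \<sigma>) + q * mag g i = av g (\<lambda>\<sigma>. \<sigma> i * dev g \<sigma> + q * \<sigma> i)"
        by (simp add: gavg1_add gavg1_cmult mag_def)
      also have "\<dots> = av g (\<lambda>\<sigma>. (\<Sum>k\<in>J. mag g k * (\<sigma> i * \<sigma> k)) / real N)"
      proof (rule gavg1_cong)
        fix \<sigma>
        have "\<sigma> i * dev g \<sigma> + q * \<sigma> i = \<sigma> i * ((\<Sum>k\<in>J. mag g k * \<sigma> k) / real N)"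
          unfolding avg by (simp add: algebra_simps)
        then show "\<sigma> i * dev g \<sigma> + q * \<sigma> i = (\<Sum>k\<in>J. mag g k * (\<sigma> i * \<sigma> k)) / real N"
          by (simp add: sum_distrib_left mult_ac)
      qed
      also have "\<dots> = (\<Sum>k\<in>J. mag g k * cor g k) / real N"
        by (simp add: gavg1_divide gavg1_sum gavg1_cmult cor_def)
      finally have 2: "av g (\<lambda>\<sigma>. \<sigma> i * dev g \<sigma>) + q * mag g i = (\<Sum>k\<in>J. mag g k * cor g k) / real N" .
      have "\<epsilon> * (\<Sum>k\<in>J. ?D g k) = (\<epsilon> * \<epsilon>) * \<beta> * (\<Sum>k\<in>J. mag g i - mag g k * cor g k)"
        by (simp add: sum_distrib_left mult.assoc)
      also have "\<dots> = \<beta> * ((real (card J) / real N) * mag g i - (\<Sum>k\<in>J. mag g k * cor g k) / real N)"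
        unfolding eps_sq sum_subtractf by (simp add: right_diff_distrib diff_divide_distrib)
      finally show ?thesis unfolding 2 card_J .
    qed
    \<comment> \<open>The weights \<open>mag g k\<close> average to \<open>dev\<close> plus
      \<open>q\<close>. The \<open>q\<close> part sees only the mean of \<open>field\<close>, which
      is the defect; the rest is an overlap error.\<close>
    have 2: "\<epsilon> * (\<Sum>k\<in>J. mag g k * (\<epsilon> * mag g k + \<epsilon> * \<beta> * av g (\<lambda>\<sigma>. field g \<sigma> * \<sigma> k)))
        = magsq g + \<beta> * (av g (\<lambda>\<sigma>. field g \<sigma> * dev g \<sigma>) + q * defect g)"
    proof -
      have "av g (\<lambda>\<sigma>. field g \<sigma> * dev g \<sigma>) + q * defect g = av g (\<lambda>\<sigma>. field g \<sigma> * dev g \<sigma> + q * field g \<sigma>)"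
        by (simp add: gavg1_add gavg1_cmult av_field_1)
      also have "\<dots> = av g (\<lambda>\<sigma>. (\<Sum>k\<in>J. mag g k * (field g \<sigma> * \<sigma> k)) / real N)"
      proof (rule gavg1_cong)
        fix \<sigma>
        have "field g \<sigma> * dev g \<sigma> + q * field g \<sigma> = field g \<sigma> * ((\<Sum>k\<in>J. mag g k * \<sigma> k) / real N)"
          unfolding avg by (simp add: algebra_simps)
        then show "field g \<sigma> * dev g \<sigma> + q * field g \<sigma> = (\<Sum>k\<in>J. mag g k * (field g \<sigma> * \<sigma> k)) / real N"
          by (simp add: sum_distrib_left mult_ac)
      qed
      also have "\<dots> = (\<Sum>k\<in>J. mag g k * av g (\<lambda>\<sigma>. field g \<sigma> * \<sigma> k)) / real N"
        by (simp add: gavg1_divide gavg1_sum gavg1_cmult)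
      finally have 3: "av g (\<lambda>\<sigma>. field g \<sigma> * dev g \<sigma>) + q * defect g
        = (\<Sum>k\<in>J. mag g k * av g (\<lambda>\<sigma>. field g \<sigma> * \<sigma> k)) / real N" .
      have "\<epsilon> * (\<Sum>k\<in>J. mag g k * (\<epsilon> * mag g k + \<epsilon> * \<beta> * av g (\<lambda>\<sigma>. field g \<sigma> * \<sigma> k)))
          = (\<epsilon> * \<epsilon>) * (\<Sum>k\<in>J. mag g k * mag g k) + (\<epsilon> * \<epsilon>) * \<beta> * (\<Sum>k\<in>J. mag g k * av g (\<lambda>\<sigma>. field g \<sigma> * \<sigma> k))"
        by (simp add: sum_distrib_left distrib_left sum.distrib mult_ac)
      then show ?thesis unfolding 3 eps_sq magsq_def by simp
    qed
    have "Y g = (\<epsilon> * (\<Sum>k\<in>J. ?D g k)) * ?f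
        + ?f' * (\<epsilon> * (\<Sum>k\<in>J. mag g k * (\<epsilon> * mag g k + \<epsilon> * \<beta> * av g (\<lambda>\<sigma>. field g \<sigma> * \<sigma> k))))"
      unfolding Y_def sum.distrib by (simp add: sum_distrib_right sum_distrib_left distrib_left mult_ac)
    \<comment> \<open>Both main terms, \<open>q * ?f'\<close> and \<open>b * mag g i * ?f\<close>,
      have cancelled; each surviving term carries a small factor.\<close>
    then have R_eq: "R g = \<beta> * (mag g i / real N + av g (\<lambda>\<sigma>. \<sigma> i * dev g \<sigma>)) * ?f
        - ?f' * ((magsq g - q) + \<beta> * av g (\<lambda>\<sigma>. field g \<sigma> * dev g \<sigma>) + \<beta> * q * defect g)"
      unfolding 1 2 R_def by (simp add: b_def algebra_simps)
    have "\<bar>\<beta> * (mag g i / real N + av g (\<lambda>\<sigma>. \<sigma> i * dev g \<sigma>)) * ?f\<bar> \<le> \<beta> * (2 * ?k) * A"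
    proof -
      have "\<bar>mag g i / real N\<bar> \<le> ?k"
        using mag_bound[OF site, of g] inverse_N_le[of g] N_pos
        by (simp add: abs_div order_trans[OF divide_right_mono[of _ 1]])
      moreover have "\<bar>av g (\<lambda>\<sigma>. \<sigma> i * dev g \<sigma>)\<bar> \<le> ?k"
        using av_dev_bound[of "\<lambda>\<sigma>. \<sigma> i" 0 g 1] spin_abs[OF _ site] by simp
      ultimately have "\<bar>mag g i / real N + av g (\<lambda>\<sigma>. \<sigma> i * dev g \<sigma>)\<bar> \<le> 2 * ?k" by linarith
      then show ?thesis unfolding abs_mult using beta_pos A[of "cav g"] r A0 by (intro mult_mono) auto
    qed
    moreover have "\<bar>?f' * ((magsq g - q) + \<beta> * av g (\<lambda>\<sigma>. field g \<sigma> * dev g \<sigma>) + \<beta> * q * defect g)\<bar>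
        \<le> A' * (?k + \<beta> * ((2 * ?r + 2 * \<beta>) * ?k) + \<beta> * \<bar>defect g\<bar>)"
    proof -
      have "\<bar>av g (\<lambda>\<sigma>. field g \<sigma> * dev g \<sigma>)\<bar> \<le> (1 * ?r + (?r + 2 * \<beta>)) * ?k"
        using r beta_pos by (intro av_dev_bound field_bound) auto
      then have "\<bar>\<beta> * av g (\<lambda>\<sigma>. field g \<sigma> * dev g \<sigma>)\<bar> \<le> \<beta> * ((2 * ?r + 2 * \<beta>) * ?k)"
        using beta_pos by (simp add: abs_mult)
      moreover have "\<bar>\<beta> * q * defect g\<bar> \<le> \<beta> * \<bar>defect g\<bar>"
        using beta_pos q_pos q_less mult_left_le_one_le[of "\<bar>defect g\<bar>" q] by (simp add: abs_mult mult.assoc)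
      ultimately have "\<bar>(magsq g - q) + \<beta> * av g (\<lambda>\<sigma>. field g \<sigma> * dev g \<sigma>) + \<beta> * q * defect g\<bar>
          \<le> ?k + \<beta> * ((2 * ?r + 2 * \<beta>) * ?k) + \<beta> * \<bar>defect g\<bar>"
        using magsq_bound[of g] by linarith
      then show ?thesis unfolding abs_mult[of ?f'] using A' A0 by (intro mult_mono) auto
    qed
    ultimately have "\<bar>R g\<bar> \<le> \<beta> * (2 * ?k) * A + A' * (?k + \<beta> * ((2 * ?r + 2 * \<beta>) * ?k) + \<beta> * \<bar>defect g\<bar>)"
      unfolding R_eq by linarith
    also have "\<dots> = (2 * \<beta> * A + A' * (1 + 2 * \<beta> * ?r + 2 * \<beta>\<^sup>2)) * ?k + A' * \<beta> * \<bar>defect g\<bar>"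
      by (simp add: power2_eq_square algebra_simps)
    also have "\<dots> \<le> (P * (1 + ?r)) * ?k + A' * \<beta> * \<bar>defect g\<bar>"
    proof -
      have "0 \<le> 2 * \<beta> * A * ?r + A' * ?r + A' * 2 * \<beta> + A' * 2 * \<beta>\<^sup>2 * ?r"
        using A0 beta_pos r by (intro add_nonneg_nonneg mult_nonneg_nonneg) auto
      then have "2 * \<beta> * A + A' * (1 + 2 * \<beta> * ?r + 2 * \<beta>\<^sup>2) \<le> P * (1 + ?r)"
        unfolding P_def by (simp add: algebra_simps)
      then show ?thesis using r by (intro add_right_mono mult_right_mono)
    qed
    also have "\<dots> \<le> P * ?err g + A' * \<beta> * \<bar>defect g\<bar>"
      unfolding mult.assoc[of P] using P0 by (intro add_right_mono mult_left_mono error_bound)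
    finally show ?thesis .
  qed
  let ?d = "sqrt \<epsilon>"
  have d: "0 < ?d" "?d * ?d = \<epsilon>" using eps_pos by auto
  have eps_le: "\<epsilon> \<le> ?d"
  proof -
    have "1 \<le> real N" using site by simp
    then have "\<epsilon> \<le> 1" by (simp add: \<epsilon>_def)
    then have "?d * ?d \<le> ?d * 1" using d(1) by (intro mult_left_mono) auto
    then show ?thesis unfolding d(2) by simp
  qed
  have M0: "0 \<le> M" using K(2) by (simp add: M_def)
  \<comment> \<open>AM-GM at the scale \<open>sqrt \<epsilon>\<close> takes the place of
    Cauchy-Schwarz in the disorder: with a mean square of order \<epsilon>, both summands have mean
    of order \<open>sqrt \<epsilon>\<close>.\<close>
  have abs_le: "\<bar>defect g\<bar> \<le> ?d / 2 + (defect g)\<^sup>2 / (2 * ?d)" for g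
  proof -
    have "0 \<le> (?d - \<bar>defect g\<bar>)\<^sup>2" by simp
    then have "2 * ?d * \<bar>defect g\<bar> \<le> ?d * ?d + (defect g)\<^sup>2"
      using eps_pos by (simp add: power2_diff)
    also have "\<dots> = 2 * ?d * (?d / 2 + (defect g)\<^sup>2 / (2 * ?d))" using d(1) by (simp add: field_simps)
    finally show ?thesis using d(1) by (simp only: mult_le_cancel_left_pos zero_less_mult_iff zero_less_numeral simp_thms)
  qed
  have defect_abs: "EE (\<lambda>g. \<bar>defect g\<bar>) \<le> (1 + (4 + 24 * \<beta> + 14 * \<beta>\<^sup>2) * M) * ?d"
  proof -
    have "EE (\<lambda>g. \<bar>defect g\<bar>) \<le> EE (\<lambda>g. ?d / 2 + (defect g)\<^sup>2 / (2 * ?d))"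
      using abs_le unfolding divide_inverse
      by (intro integral_mono tame_integrable finite_pairs tame_intros tame_defect)
    also have "\<dots> = ?d / 2 + EE (\<lambda>g. (defect g)\<^sup>2) / (2 * ?d)"
      using tame_integrable[OF finite_pairs tame_power[OF tame_defect, of 2]] prob_space by simp
    also have "\<dots> \<le> ?d / 2 + (4 + 24 * \<beta> + 14 * \<beta>\<^sup>2) * (M * \<epsilon>) / (2 * ?d)"
      using defect_expectation[OF K(1)] d(1) unfolding M_def by (intro add_left_mono divide_right_mono) auto
    also have "\<dots> = (1 + (4 + 24 * \<beta> + 14 * \<beta>\<^sup>2) * M) * ?d / 2"
    proof -
      have "t / 2 + c * (M * (t * t)) / (2 * t) = (1 + c * M) * t / 2" if "0 < t" for t c :: real
        using that by (simp add: field_simps)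
      from this[OF d(1)] show ?thesis unfolding d(2) .
    qed
    also have "\<dots> \<le> (1 + (4 + 24 * \<beta> + 14 * \<beta>\<^sup>2) * M) * ?d"
    proof -
      have "0 \<le> (1 + (4 + 24 * \<beta> + 14 * \<beta>\<^sup>2) * M) * ?d"
        using beta_pos M0 d(1) by (intro mult_nonneg_nonneg add_nonneg_nonneg) auto
      then show ?thesis by linarith
    qed
    finally show ?thesis .
  qed
  have "\<bar>EE R\<bar> \<le> EE (\<lambda>g. \<bar>R g\<bar>)" by (rule integral_abs_bound)
  also have "\<dots> \<le> EE (\<lambda>g. P * ?err g + A' * \<beta> * \<bar>defect g\<bar>)"
    by (intro integral_mono R_le tame_integrable finite_pairs tame_add tame_mult tame_abs tR tame_const tame_error tame_defect)
  also have "\<dots> = P * EE ?err + A' * \<beta> * EE (\<lambda>g. \<bar>defect g\<bar>)"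
  proof -
    have "EE (\<lambda>g. P * ?err g + A' * \<beta> * \<bar>defect g\<bar>) = EE (\<lambda>g. P * ?err g) + EE (\<lambda>g. A' * \<beta> * \<bar>defect g\<bar>)"
      by (intro Bochner_Integration.integral_add tame_integrable finite_pairs tame_mult tame_abs tame_const tame_error tame_defect)
    then show ?thesis by simp
  qed
  also have "\<dots> \<le> P * (M * ?d) + A' * \<beta> * ((1 + (4 + 24 * \<beta> + 14 * \<beta>\<^sup>2) * M) * ?d)"
  proof (intro add_mono mult_left_mono defect_abs)
    have "EE ?err \<le> M * \<epsilon>" unfolding M_def by (rule expectation_error[OF K(1)])
    also have "\<dots> \<le> M * ?d" using M0 eps_le by (intro mult_left_mono)
    finally show "EE ?err \<le> M * ?d" .
  qed (use P0 A0 beta_pos in auto)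
  finally show ?thesis unfolding eq P_def by (simp add: algebra_simps)
qed

text \<open>AM-GM with weight \<open>N\<close> trades the second power for the fourth pointwise, so
  the hypothesis applies directly under the expectation. Omitting site \<open>i\<close> from the
  overlap costs \<open>1 / N\<close> at most.\<close>

lemma kappa_expectation:
  assumes R: "(\<integral>g. gavg2 N \<beta> h g (\<lambda>\<sigma>1 \<sigma>2. (overlap N \<sigma>1 \<sigma>2 - q) ^ 4) \<partial>disorder N) \<le> C0 / (real N) ^ 2"
  shows "EE \<kappa> \<le> (4 + \<bar>C0\<bar>) / real N"
proof -
  interpret prob_space "gaussian_vector (pairs N)" by (rule prob_space_gaussian_vector)
  let ?Q = "\<lambda>g. av g (\<lambda>\<sigma>. av g (\<lambda>\<tau>. (overlap N \<sigma> \<tau> - q) ^ 4))"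
  have tQ: "tame (pairs N) ?Q" by (intro tame_cav_intros)
  have N1: "1 \<le> real N" using site by simp
  have le: "\<kappa> g \<le> 4 / real N + real N * ?Q g" for g
  proof -
    \<comment> \<open>The 3 is two from the doubled square of the omitted term and one from AM-GM;
      the summand \<open>1 / N\<close> in \<kappa> raises it to 4.\<close>
    have "(ov \<sigma> \<tau> - q)\<^sup>2 \<le> 3 / real N + real N * (overlap N \<sigma> \<tau> - q) ^ 4"
      if \<sigma>: "\<sigma> \<in> spins N" and \<tau>: "\<tau> \<in> spins N" for \<sigma> \<tau>
    proof -
      let ?x = "overlap N \<sigma> \<tau> - q" and ?y = "\<sigma> i * \<tau> i / real N"
      have "(\<Sum>k<N. \<sigma> k * \<tau> k) = \<sigma> i * \<tau> i + (\<Sum>k\<in>J. \<sigma> k * \<tau> k)"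
        unfolding J_def using site by (intro sum.remove) auto
      then have ov: "ov \<sigma> \<tau> - q = ?x - ?y" by (simp add: ov_def overlap_def add_divide_distrib)
      have "\<bar>\<sigma> i * \<tau> i\<bar> = 1" using spin_abs[OF \<sigma> site] spin_abs[OF \<tau> site] by (simp add: abs_mult)
      then have "(\<sigma> i * \<tau> i)\<^sup>2 = 1" by (metis power2_abs one_power2)
      then have "?y\<^sup>2 = 1 / (real N)\<^sup>2" by (simp only: power_divide)
      also have "\<dots> \<le> 1 / real N" using N1 by (simp add: power2_eq_square divide_simps)
      finally have y: "?y\<^sup>2 \<le> 1 / real N" .
      have "(x - y)\<^sup>2 \<le> 2 * x\<^sup>2 + 2 * y\<^sup>2" for x y :: real
        using zero_le_power2[of "x + y"] by (simp add: power2_sum power2_diff)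
      then have "(?x - ?y)\<^sup>2 \<le> 2 * ?x\<^sup>2 + 2 * ?y\<^sup>2" .
      moreover have "2 * ?x\<^sup>2 \<le> 1 / real N + real N * ?x ^ 4"
      proof -
        have "0 \<le> (1 - real N * ?x\<^sup>2)\<^sup>2 / real N" by simp
        also have "\<dots> = 1 / real N - 2 * ?x\<^sup>2 + real N * ?x ^ 4"
          using N1 by (simp add: power2_eq_square power4_eq_xxxx field_simps)
        finally show ?thesis by linarith
      qed
      ultimately show ?thesis using y unfolding ov by linarith
    qed
    then have "av g (\<lambda>\<sigma>. av g (\<lambda>\<tau>. (ov \<sigma> \<tau> - q)\<^sup>2))
        \<le> av g (\<lambda>\<sigma>. av g (\<lambda>\<tau>. 3 / real N + real N * (overlap N \<sigma> \<tau> - q) ^ 4))"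
      by (intro gavg1_mono)
    also have "\<dots> = 3 / real N + real N * ?Q g" by (simp only: gavg1_add gavg1_cmult gavg1_const)
    finally show ?thesis unfolding \<kappa>_def by (simp add: add_divide_distrib)
  qed
  have "EE \<kappa> \<le> EE (\<lambda>g. 4 / real N + real N * ?Q g)"
    by (intro integral_mono le tame_integrable finite_pairs tame_add tame_mult tame_const tame_defs tQ)
  also have "\<dots> = 4 / real N + real N * EE ?Q"
    using tame_integrable[OF finite_pairs tQ] prob_space by simp
  also have "\<dots> \<le> 4 / real N + real N * (\<bar>C0\<bar> / (real N)\<^sup>2)"
  proof -
    have "EE ?Q \<le> C0 / (real N)\<^sup>2" using R by (simp add: disorder_def gavg2_eq)
    \<comment> \<open>The absolute value makes the resulting constant visibly nonnegative, as the
      Stein bound requires of \<open>K\<close>.\<close>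
    also have "\<dots> \<le> \<bar>C0\<bar> / (real N)\<^sup>2" by (intro divide_right_mono) auto
    finally show ?thesis by (intro add_left_mono mult_left_mono) auto
  qed
  also have "\<dots> = (4 + \<bar>C0\<bar>) / real N"
    using N1 by (simp add: power2_eq_square add_divide_distrib)
  finally show ?thesis .
qed

text \<open>Stein's equation is solved for \<open>v (x * sqrt q)\<close> at unit variance and
  rescaled: the function \<open>f (y / sqrt q)\<close> satisfies the equation for variance
  \<open>q\<close>, with right-hand side multiplied by \<open>sqrt q\<close>. Dividing by that
  factor gives the outer \<open>sqrt q\<close> in the constant.\<close>

lemma cavity_field_continuous:
  fixes v :: "real \<Rightarrow> real"
  assumes K: "EE \<kappa> \<le> K / real N" "0 \<le> K"
    and v: "continuous_on UNIV v" and B: "\<And>x. \<bar>v x\<bar> \<le> B"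
  defines "M \<equiv> 3 + 4 * \<beta>\<^sup>2 + K"
  shows "\<bar>EE (\<lambda>g. v (cav g)) - (\<integral>z. v (z * sqrt q) \<partial>std_normal_distribution)\<bar>
    \<le> (((4 * \<beta> / std_normal_density 1 + 4 / sqrt q * (1 + 2 * \<beta> + 2 * \<beta>\<^sup>2)) * M
        + 4 / sqrt q * \<beta> * (1 + (4 + 24 * \<beta> + 14 * \<beta>\<^sup>2) * M)) / sqrt q) * B * sqrt \<epsilon>"
proof -
  interpret prob_space "gaussian_vector (pairs N)" by (rule prob_space_gaussian_vector)
  let ?s = "sqrt q"
  have s: "0 < ?s" "?s * ?s = q" using q_pos by auto
  have cont: "continuous_on UNIV (\<lambda>x. v (x * ?s))"
    by (intro continuous_on_compose2[OF v] continuous_intros) auto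
  obtain f f' where f: "\<And>x. (f has_real_derivative f' x) (at x)"
    "\<And>x. f' x - x * f x = v (x * ?s) - (\<integral>z. v (z * ?s) \<partial>std_normal_distribution)"
    "\<And>x. \<bar>f x\<bar> \<le> 2 * B / std_normal_density 1" "\<And>x. \<bar>f' x\<bar> \<le> 4 * B"
    "f' \<in> borel_measurable borel"
    by (rule stein_equation[OF cont B]) (rule that)
  let ?m = "\<integral>z. v (z * ?s) \<partial>std_normal_distribution"
  let ?F = "\<lambda>y. f (y / ?s)" and ?F' = "\<lambda>y. f' (y / ?s) / ?s"
  have dF: "(?F has_real_derivative ?F' y) (at y)" for y
  proof -
    have "((\<lambda>y. y / ?s) has_real_derivative 1 / ?s) (at y)"
      by (rule DERIV_cdivide[OF DERIV_ident])
    from DERIV_chain2[OF f(1) this] show ?thesis by simp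
  qed
  have F'_meas: "?F' \<in> borel_measurable borel" using f(5) by measurable
  have F'_le: "\<bar>?F' y\<bar> \<le> 4 * B / ?s" for y
    using f(4)[of "y / ?s"] s(1) by (simp add: abs_div divide_right_mono)
  have bound: "\<bar>EE (\<lambda>g. q * ?F' (cav g) - cav g * ?F (cav g))\<bar>
    \<le> ((2 * \<beta> * (2 * B / std_normal_density 1) + 4 * B / ?s * (1 + 2 * \<beta> + 2 * \<beta>\<^sup>2)) * M
        + 4 * B / ?s * \<beta> * (1 + (4 + 24 * \<beta> + 14 * \<beta>\<^sup>2) * M)) * sqrt \<epsilon>"
    unfolding M_def by (rule stein_bound[OF K dF F'_meas f(3) F'_le])
  have v_meas: "v \<in> borel_measurable borel" by (rule borel_measurable_continuous_onI[OF v])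
  have tv: "tame (pairs N) (\<lambda>g. v (cav g))"
    by (rule tame_bounded[OF measurable_compose[OF tame_measurable[OF tame_cav] v_meas] B])
  have "q * ?F' y - y * ?F y = ?s * (v y - ?m)" for y
  proof -
    have "q * ?F' y - y * ?F y = ?s * (f' (y / ?s) - y / ?s * f (y / ?s))"
      using s by (simp add: field_simps)
    also have "\<dots> = ?s * (v y - ?m)" unfolding f(2) using s(1) by simp
    finally show ?thesis .
  qed
  then have "EE (\<lambda>g. q * ?F' (cav g) - cav g * ?F (cav g)) = ?s * (EE (\<lambda>g. v (cav g)) - ?m)"
    using tame_integrable[OF finite_pairs tv] prob_space by simp
  then have "?s * \<bar>EE (\<lambda>g. v (cav g)) - ?m\<bar>
    \<le> ((2 * \<beta> * (2 * B / std_normal_density 1) + 4 * B / ?s * (1 + 2 * \<beta> + 2 * \<beta>\<^sup>2)) * M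
        + 4 * B / ?s * \<beta> * (1 + (4 + 24 * \<beta> + 14 * \<beta>\<^sup>2) * M)) * sqrt \<epsilon>"
    using bound s(1) by (simp add: abs_mult)
  \<comment> \<open>Both bounds on the Stein solution are linear in \<open>B\<close>, so
    \<open>B\<close> factors out; the linear dependence on the supremum of \<open>u\<close> comes
    from here.\<close>
  also have "\<dots> = ?s * ((((4 * \<beta> / std_normal_density 1 + 4 / ?s * (1 + 2 * \<beta> + 2 * \<beta>\<^sup>2)) * M
        + 4 / ?s * \<beta> * (1 + (4 + 24 * \<beta> + 14 * \<beta>\<^sup>2) * M)) / ?s) * B * sqrt \<epsilon>)"
    (is "_ = ?s * ?rhs")
  proof -
    have "(2 * \<beta> * (2 * B / d) + 4 * B / t * u) * M + 4 * B / t * \<beta> * w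
        = B * ((4 * \<beta> / d + 4 / t * u) * M + 4 / t * \<beta> * w)" for d t u w :: real
      by (simp add: algebra_simps)
    then show ?thesis using s(1) by simp
  qed
  finally show ?thesis using s(1) by (simp only: mult_le_cancel_left_pos)
qed

end

section \<open>The law of the cavity field, uniformly in size, site and test function\<close>

theorem theorem1p7:
  fixes \<beta> h q C0 :: real
  assumes "\<beta> > 0" and "0 < q" and "q < 1"
    and "\<forall>N::nat. N \<ge> 1 \<longrightarrow>
           (\<integral>g. gavg2 N \<beta> h g (\<lambda>\<sigma>1 \<sigma>2. (overlap N \<sigma>1 \<sigma>2 - q) ^ 4) \<partial>disorder N)
             \<le> C0 / (real N) ^ 2"
  shows "\<exists>C::real. \<forall>N::nat. \<forall>i<N. \<forall>u::real \<Rightarrow> real.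
           u \<in> borel_measurable borel \<longrightarrow> bounded (range u) \<longrightarrow>
           \<bar>(\<integral>g. u (cav_r N \<beta> h q g i) \<partial>disorder N)
             - (\<integral>z. u (z * sqrt q) \<partial>std_normal_distribution)\<bar>
           \<le> C * (SUP x. \<bar>u x\<bar>) / root 4 (real N)"
proof -
  \<comment> \<open>The constants are fixed before \<open>N\<close>, \<open>i\<close> and
    \<open>u\<close>; the summand \<open>4 + \<bar>C0\<bar>\<close> is the bound for
    \<open>N\<close> times the mean of \<kappa>.\<close>
  define M where "M = 3 + 4 * \<beta>\<^sup>2 + (4 + \<bar>C0\<bar>)"
  define C where "C = ((4 * \<beta> / std_normal_density 1 + 4 / sqrt q * (1 + 2 * \<beta> + 2 * \<beta>\<^sup>2)) * M
        + 4 / sqrt q * \<beta> * (1 + (4 + 24 * \<beta> + 14 * \<beta>\<^sup>2) * M)) / sqrt q"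
  have "\<bar>(\<integral>g. u (cav_r N \<beta> h q g i) \<partial>disorder N) - (\<integral>z. u (z * sqrt q) \<partial>std_normal_distribution)\<bar>
      \<le> C * (SUP x. \<bar>u x\<bar>) / root 4 (real N)"
    if i: "i < N" and u: "u \<in> borel_measurable borel" and bdd: "bounded (range u)" for N i and u :: "real \<Rightarrow> real"
  proof -
    interpret cavity N i \<beta> h q using i assms(1-3) by unfold_locales
    have K: "EE \<kappa> \<le> (4 + \<bar>C0\<bar>) / real N"
      using i assms(4) by (intro kappa_expectation) auto
    let ?B = "SUP x. \<bar>u x\<bar>"
    have "bdd_above (range (\<lambda>x. \<bar>u x\<bar>))"
      using bdd by (auto simp: bounded_iff bdd_above_def)
    then have B: "\<bar>u x\<bar> \<le> ?B" for x by (intro cSUP_upper) auto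
    have cav_meas: "cav \<in> measurable (gaussian_vector (pairs N)) borel"
      by (rule tame_measurable[OF tame_cav])
    have scale_meas: "(\<lambda>z. z * sqrt q) \<in> measurable std_normal_distribution borel" by measurable
    \<comment> \<open>Passing to the image laws on the line puts the two expectations in the form of
      the approximation lemma, with a single function integrated against two measures.\<close>
    let ?L = "distr (gaussian_vector (pairs N)) borel cav"
    let ?G = "distr std_normal_distribution borel (\<lambda>z. z * sqrt q)"
    have "\<bar>(\<integral>x. u x \<partial>?L) - (\<integral>x. u x \<partial>?G)\<bar> \<le> C * ?B * sqrt \<epsilon>"
    proof (rule integral_diff_bound_from_continuous[OF _ _ _ _ _ u B])
      show "prob_space ?L" by (rule prob_space.prob_space_distr[OF prob_space_gaussian_vector cav_meas])
      show "prob_space ?G" by (rule prob_space.prob_space_distr[OF prob_space_std_normal scale_meas])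
      fix v :: "real \<Rightarrow> real" assume v: "continuous_on UNIV v" "\<And>x. \<bar>v x\<bar> \<le> ?B"
      have "v \<in> borel_measurable borel" by (rule borel_measurable_continuous_onI[OF v(1)])
      then show "\<bar>(\<integral>x. v x \<partial>?L) - (\<integral>x. v x \<partial>?G)\<bar> \<le> C * ?B * sqrt \<epsilon>"
        using cavity_field_continuous[OF K _ v] unfolding C_def M_def
        by (simp add: integral_distr[OF cav_meas] integral_distr[OF scale_meas])
    qed auto
    moreover have "sqrt \<epsilon> = 1 / root 4 (real N)"
      using real_root_mult_exp[of 2 2 "real N"] by (simp add: \<epsilon>_def sqrt_def real_root_divide)
    ultimately show ?thesis
      by (simp add: integral_distr[OF cav_meas u] integral_distr[OF scale_meas u] disorder_def cav_eq)
  qed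
  then show ?thesis by blast
qed

end
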